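(* Assume the true function satisfies $f_0\in L^2_\rho(\mathcal X)$ with $f_0=\sum_{j=1}^\infty\theta_{0j}\phi_j$ in $L^2_\rho(\mathcal X)$, $\theta_{0j}=\int f_0\phi_j\rho\,dx$. Assume the eigenfunctions $\{\phi_j\}$ and eigenvalues $\{\lambda_j\}$ of the kernel $K$ with respect to the covariate density $\rho$ satisfy: (i) $\|\Lambda^{-1}\|_2<n/4$, where $\Lambda=\mathrm{diag}(\lambda_1,\dots,\lambda_{k_n})$; (ii) $\sup_{x\in\mathcal X}|\phi_j(x)|\le L_n$ for all $j=1,\dots,k_n$, with $L_n^2k_n\log k_n<n$. Let $A_n\subset\mathcal X^n$ be the set $A_n=\{\|\Phi^{\mathrm T}\Phi-n\mathrm I_{k_n}\|_2<n/2\}$, where $\Phi=(\phi_j(X_i))_{1\le i\le n,1\le j\le k_n}$. Then the tGP posterior $\widetilde{\mathcal W}^t(\cdot\mid Y,X)$ satisfies $$\mathbb E_0\Big\{\mathbf 1_{A_n}(X)\,d_{W,2}^2\Big[\widetilde{\mathcal W}^t(\cdot\mid Y,X),\ \mathrm N_{k_n}\big(\theta_0^t,\tfrac{\sigma^2}{n}\mathrm I_{k_n}\big)\Big]\Big\}\lesssim\sigma^2\frac{k_n}{n}+\frac{\|\theta_0^t\|_{\mathbb H}^2}{n}+\|f_0-f_0^t\|_{2,\rho}^2 .$$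
   Context: $\rho$ is a known probability density on $\mathcal X\subset\mathbb R^d$ ($\mathcal X$ possibly unbounded); $\|g\|_{2,\rho}^2=\int g(x)^2\rho(x)\,dx$. $\sigma^2>0$ is known. $K$ is a positive definite correlation function ($K(x,x)=1$) with Mercer expansion $K(x,x')=\sum_{j\ge1}\lambda_j\phi_j(x)\phi_j(x')$, where $\{\phi_j\}$ is orthonormal in $L^2_\rho(\mathcal X)$ and $\int K(x,x')\phi_j(x')\rho(x')\,dx'=\lambda_j\phi_j(x)$. $k_n$ is a positive integer. Truth: $X_1,\dots,X_n$ i.i.d. from $\rho$ and, given $X=(X_1,\dots,X_n)$, $Y_i\sim\mathrm N(f_0(X_i),\sigma^2)$ independently; $\mathbb E_0$ is expectation under the joint law of $(Y,X)$. Put $f_0^t=\sum_{j=1}^{k_n}\theta_{0j}\phi_j$, $\theta_0^t=(\theta_{01},\dots,\theta_{0k_n})^{\mathrm T}$, $\|\theta_0^t\|_{\mathbb H}^2=\sum_{j=1}^{k_n}\theta_{0j}^2/\lambda_j$. tGP posterior: the posterior of $\theta^t$ in the model $Y\sim\mathrm N(\Phi\theta^t,\sigma^2\mathrm I_n)$, $\theta^t\sim\mathrm N_{k_n}(0,\sigma^2\Lambda)$, namely $\widetilde{\mathcal W}^t(\cdot\mid Y,X)=\mathrm N_{k_n}(\widetilde\theta,\widetilde\Sigma)$ with $\widetilde\theta=(\Phi^{\mathrm T}\Phi+\Lambda^{-1})^{-1}\Phi^{\mathrm T}Y$, $\widetilde\Sigma=\sigma^2(\Phi^{\mathrm T}\Phi+\Lambda^{-1})^{-1}$.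 $\|\cdot\|_2$ on matrices is the operator norm. $d_{W,2}(P,Q)=\inf(\mathbb E\|U-V\|^2)^{1/2}$ is the $L^2$ Wasserstein distance, the infimum being over all couplings $U\sim P$, $V\sim Q$. $\lesssim$ denotes inequality up to a positive constant multiple that is independent of everything else. *)

theory Defs
  imports "HOL-Probability.Probability" "Jordan_Normal_Form.Determinant"
    "Jordan_Normal_Form.Gauss_Jordan_Elimination"
begin

hide_const (open) Finite_Cartesian_Product.vec Finite_Cartesian_Product.mat
  Determinants.det Finite_Cartesian_Product.transpose

text \<open>
  The constant of the main inequality must be uniform in all dimensions, so no dimension may be a
  type. Points of \<open>\<real>\<^sup>d\<close> are extensional functions on \<open>{..<d}\<close>; linear algebra is done with the
  dimension-indexed vectors and matrices of \<^theory>\<open>Jordan_Normal_Form.Matrix\<close>. All indices start at \<open>0\<close>: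
  \<open>lam j\<close>, \<open>\<phi> j\<close> are the eigenvalue and eigenfunction number \<open>j + 1\<close>.
\<close>

definition euclid :: "nat \<Rightarrow> (nat \<Rightarrow> real) measure" where
  "euclid d = (\<Pi>\<^sub>M i\<in>{..<d}. lborel)"

definition vec_norm2 :: "real vec \<Rightarrow> real" where
  "vec_norm2 v = sqrt (v \<bullet> v)"

definition op_norm :: "real mat \<Rightarrow> real" where
  "op_norm A = Sup {vec_norm2 (A *\<^sub>v v) | v. v \<in> carrier_vec (dim_col A) \<and> vec_norm2 v \<le> 1}"

text \<open>Only meaningful for invertible matrices.\<close>

definition mat_inv :: "real mat \<Rightarrow> real mat" where
  "mat_inv A = the (mat_inverse A)"

text \<open>\<open>N\<^sub>k(m, S)\<close> with \<open>k = dim_vec m\<close>, for positive definite \<open>S\<close>, by its Lebesgue density.\<close>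

definition gaussian :: "real vec \<Rightarrow> real mat \<Rightarrow> (nat \<Rightarrow> real) measure" where
  "gaussian m S = density (euclid (dim_vec m)) (\<lambda>x. let v = vec (dim_vec m) x - m in
     ennreal (exp (- (v \<bullet> (mat_inv S *\<^sub>v v)) / 2) / sqrt ((2 * pi) ^ dim_vec m * det S)))"

definition couplings :: "'a measure \<Rightarrow> 'a measure \<Rightarrow> ('a \<times> 'a) measure set" where
  "couplings P Q =
     {J. sets J = sets (P \<Otimes>\<^sub>M Q) \<and> distr J P fst = P \<and> distr J Q snd = Q}"

definition ennreal_sqrt :: "ennreal \<Rightarrow> ennreal" where
  "ennreal_sqrt x = (if x = \<top> then \<top> else ennreal (sqrt (enn2real x)))"

definition wasserstein2 ::
    "nat \<Rightarrow> (nat \<Rightarrow> real) measure \<Rightarrow> (nat \<Rightarrow> real) measure \<Rightarrow> ennreal" where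
  "wasserstein2 k P Q =
     (INF J\<in>couplings P Q. ennreal_sqrt (\<integral>\<^sup>+(u, v). ennreal (\<Sum>i<k. (u i - v i)\<^sup>2) \<partial>J))"

definition is_density :: "nat \<Rightarrow> (nat \<Rightarrow> real) set \<Rightarrow> ((nat \<Rightarrow> real) \<Rightarrow> real) \<Rightarrow> bool" where
  "is_density d D \<rho> \<longleftrightarrow> D \<in> sets (euclid d) \<and>
     \<rho> \<in> borel_measurable (restrict_space (euclid d) D) \<and> (\<forall>x\<in>D. 0 \<le> \<rho> x) \<and>
     (\<integral>\<^sup>+x. ennreal (\<rho> x) \<partial>restrict_space (euclid d) D) = 1"

definition covariate_law ::
    "nat \<Rightarrow> (nat \<Rightarrow> real) set \<Rightarrow> ((nat \<Rightarrow> real) \<Rightarrow> real) \<Rightarrow> (nat \<Rightarrow> real) measure" where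
  "covariate_law d D \<rho> = density (restrict_space (euclid d) D) (\<lambda>x. ennreal (\<rho> x))"

text \<open>
  Members of \<open>L\<^sup>2\<^sub>\<rho>\<close> are functions, not classes: \<open>f0\<close> and the eigenfunctions are evaluated at the design
  points. Here and below \<open>P\<close> is the covariate law, so \<open>\<integral>x. g x \<partial>P\<close> is the integral of \<open>g \<rho>\<close>.
\<close>

definition square_integrable :: "'a measure \<Rightarrow> ('a \<Rightarrow> real) \<Rightarrow> bool" where
  "square_integrable P g \<longleftrightarrow> g \<in> borel_measurable P \<and> integrable P (\<lambda>x. (g x)\<^sup>2)"

definition L2_norm :: "'a measure \<Rightarrow> ('a \<Rightarrow> real) \<Rightarrow> real" where
  "L2_norm P g = sqrt (\<integral>x. (g x)\<^sup>2 \<partial>P)"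

definition orthonormal_L2 :: "'a measure \<Rightarrow> (nat \<Rightarrow> 'a \<Rightarrow> real) \<Rightarrow> bool" where
  "orthonormal_L2 P \<phi> \<longleftrightarrow> (\<forall>j. square_integrable P (\<phi> j)) \<and>
     (\<forall>i j. (\<integral>x. \<phi> i x * \<phi> j x \<partial>P) = (if i = j then 1 else 0))"

definition correlation_kernel :: "'a set \<Rightarrow> ('a \<Rightarrow> 'a \<Rightarrow> real) \<Rightarrow> bool" where
  "correlation_kernel D K \<longleftrightarrow>
     (\<forall>x\<in>D. \<forall>y\<in>D. K x y = K y x) \<and>
     (\<forall>S c. finite S \<longrightarrow> S \<subseteq> D \<longrightarrow> 0 \<le> (\<Sum>x\<in>S. \<Sum>y\<in>S. c x * c y * K x y)) \<and>
     (\<forall>x\<in>D. K x x = 1)"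

text \<open>
  Zero eigenvalues are allowed, so kernels of finite rank are covered; positivity of the first
  \<open>k\<close> eigenvalues comes from the invertibility of \<open>\<Lambda>\<close>.
\<close>

definition mercer_expansion ::
    "'a measure \<Rightarrow> ('a \<Rightarrow> 'a \<Rightarrow> real) \<Rightarrow> (nat \<Rightarrow> real) \<Rightarrow> (nat \<Rightarrow> 'a \<Rightarrow> real) \<Rightarrow> bool" where
  "mercer_expansion P K lam \<phi> \<longleftrightarrow>
     orthonormal_L2 P \<phi> \<and> (\<forall>j. 0 \<le> lam j) \<and>
     (\<forall>x\<in>space P. \<forall>y\<in>space P. (\<lambda>j. lam j * \<phi> j x * \<phi> j y) sums K x y) \<and>
     (\<forall>j. \<forall>x\<in>space P. (\<integral>y. K x y * \<phi> j y \<partial>P) = lam j * \<phi> j x)"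

definition coeff_L2 :: "'a measure \<Rightarrow> (nat \<Rightarrow> 'a \<Rightarrow> real) \<Rightarrow> ('a \<Rightarrow> real) \<Rightarrow> nat \<Rightarrow> real" where
  "coeff_L2 P \<phi> f j = (\<integral>x. f x * \<phi> j x \<partial>P)"

definition truncation ::
    "'a measure \<Rightarrow> (nat \<Rightarrow> 'a \<Rightarrow> real) \<Rightarrow> ('a \<Rightarrow> real) \<Rightarrow> nat \<Rightarrow> 'a \<Rightarrow> real" where
  "truncation P \<phi> f k x = (\<Sum>j<k. coeff_L2 P \<phi> f j * \<phi> j x)"

definition expands_in_L2 :: "'a measure \<Rightarrow> (nat \<Rightarrow> 'a \<Rightarrow> real) \<Rightarrow> ('a \<Rightarrow> real) \<Rightarrow> bool" where
  "expands_in_L2 P \<phi> f \<longleftrightarrow> (\<lambda>k. L2_norm P (\<lambda>x. f x - truncation P \<phi> f k x)) \<longlonglongrightarrow> 0"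

definition H_norm :: "(nat \<Rightarrow> real) \<Rightarrow> real vec \<Rightarrow> real" where
  "H_norm lam th = sqrt (\<Sum>j<dim_vec th. (th $ j)\<^sup>2 / lam j)"

text \<open>The joint law of \<open>(Y, X)\<close>: first the design, then the responses given the design.\<close>

definition truth ::
    "'a measure \<Rightarrow> ('a \<Rightarrow> real) \<Rightarrow> real \<Rightarrow> nat \<Rightarrow> ((nat \<Rightarrow> real) \<times> (nat \<Rightarrow> 'a)) measure" where
  "truth P f0 \<sigma> n = (\<Pi>\<^sub>M i\<in>{..<n}. P) \<bind>
     (\<lambda>X. distr (\<Pi>\<^sub>M i\<in>{..<n}. density lborel (normal_density (f0 (X i)) \<sigma>))
             ((\<Pi>\<^sub>M i\<in>{..<n}. borel) \<Otimes>\<^sub>M (\<Pi>\<^sub>M i\<in>{..<n}. P)) (\<lambda>Y. (Y, X)))"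

definition Lambda :: "(nat \<Rightarrow> real) \<Rightarrow> nat \<Rightarrow> real mat" where
  "Lambda lam k = mat_diag k lam"

definition design :: "(nat \<Rightarrow> 'a \<Rightarrow> real) \<Rightarrow> nat \<Rightarrow> nat \<Rightarrow> (nat \<Rightarrow> 'a) \<Rightarrow> real mat" where
  "design \<phi> n k X = mat n k (\<lambda>(i, j). \<phi> j (X i))"

definition gram :: "(nat \<Rightarrow> 'a \<Rightarrow> real) \<Rightarrow> nat \<Rightarrow> nat \<Rightarrow> (nat \<Rightarrow> 'a) \<Rightarrow> real mat" where
  "gram \<phi> n k X = transpose_mat (design \<phi> n k X) * design \<phi> n k X"

definition tgp_precision ::
    "(nat \<Rightarrow> real) \<Rightarrow> (nat \<Rightarrow> 'a \<Rightarrow> real) \<Rightarrow> nat \<Rightarrow> nat \<Rightarrow> (nat \<Rightarrow> 'a) \<Rightarrow> real mat" where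
  "tgp_precision lam \<phi> n k X = gram \<phi> n k X + mat_inv (Lambda lam k)"

definition tgp_mean ::
    "(nat \<Rightarrow> real) \<Rightarrow> (nat \<Rightarrow> 'a \<Rightarrow> real) \<Rightarrow> nat \<Rightarrow> nat \<Rightarrow> (nat \<Rightarrow> real) \<Rightarrow> (nat \<Rightarrow> 'a) \<Rightarrow> real vec" where
  "tgp_mean lam \<phi> n k Y X = mat_inv (tgp_precision lam \<phi> n k X) *\<^sub>v
     (transpose_mat (design \<phi> n k X) *\<^sub>v vec n Y)"

definition tgp_cov ::
    "(nat \<Rightarrow> real) \<Rightarrow> (nat \<Rightarrow> 'a \<Rightarrow> real) \<Rightarrow> real \<Rightarrow> nat \<Rightarrow> nat \<Rightarrow> (nat \<Rightarrow> 'a) \<Rightarrow> real mat" where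
  "tgp_cov lam \<phi> \<sigma> n k X = \<sigma>\<^sup>2 \<cdot>\<^sub>m mat_inv (tgp_precision lam \<phi> n k X)"

definition tgp_posterior ::
    "(nat \<Rightarrow> real) \<Rightarrow> (nat \<Rightarrow> 'a \<Rightarrow> real) \<Rightarrow> real \<Rightarrow> nat \<Rightarrow> nat \<Rightarrow>
     (nat \<Rightarrow> real) \<Rightarrow> (nat \<Rightarrow> 'a) \<Rightarrow> (nat \<Rightarrow> real) measure" where
  "tgp_posterior lam \<phi> \<sigma> n k Y X =
     gaussian (tgp_mean lam \<phi> n k Y X) (tgp_cov lam \<phi> \<sigma> n k X)"

definition good_designs ::
    "'a set \<Rightarrow> (nat \<Rightarrow> 'a \<Rightarrow> real) \<Rightarrow> nat \<Rightarrow> nat \<Rightarrow> (nat \<Rightarrow> 'a) set" where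
  "good_designs D \<phi> n k = {X \<in> {..<n} \<rightarrow>\<^sub>E D.
     op_norm (gram \<phi> n k X - real n \<cdot>\<^sub>m 1\<^sub>m k) < real n / 2}"

end

theory Submission
  imports Defs
begin

text \<open>
  The infimum defining the Wasserstein distance is bounded by one coupling, the independent one.
  Since \<open>\<bar>U - V\<bar>\<^sup>2 \<le> 3 (\<bar>U - m\<bar>\<^sup>2 + \<bar>m - m'\<bar>\<^sup>2 + \<bar>V - m'\<bar>\<^sup>2)\<close>, it leaves three terms: the second
  moments of the two Gaussians about their centres and the distance between the centres. Independence
  costs only a constant factor, because the covariances are both of order \<open>\<sigma>\<^sup>2 / n\<close> and their traces
  of order \<open>\<sigma>\<^sup>2 k / n\<close>, which is already a term of the bound.

  On a good design the Gram matrix lies between \<open>n / 2\<close> and \<open>3 n / 2\<close> (\<open>good_design_sandwich\<close>), so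
  the precision \<open>M = \<Phi>\<^sup>T \<Phi> + \<Lambda>\<^sup>-\<^sup>1\<close> satisfies \<open>M \<ge> n / 2\<close> and the posterior covariance \<open>\<sigma>\<^sup>2 M\<^sup>-\<^sup>1\<close> has trace
  at most \<open>2 \<sigma>\<^sup>2 k / n\<close> (\<open>gaussian_second_moment_le\<close>). That a Gaussian given by its density is a
  probability measure at all, and this moment bound, both come from \<open>nn_integral_gauss_quad\<close>.

  For the centres, write \<open>Y = \<Phi> \<theta> + r + \<epsilon>\<close> with \<open>r\<close> the truncation error at the design points and \<open>\<epsilon>\<close> the
  noise. Then \<open>M (\<theta>' - \<theta>) = \<Phi>\<^sup>T \<epsilon> + \<Phi>\<^sup>T r - \<Lambda>\<^sup>-\<^sup>1 \<theta>\<close> for the posterior mean \<open>\<theta>'\<close>, and \<open>M \<ge> n / 2\<close> gives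
  \<open>\<bar>\<theta>' - \<theta>\<bar>\<^sup>2 \<le> (12 / n\<^sup>2) (\<bar>\<Phi>\<^sup>T \<epsilon>\<bar>\<^sup>2 + \<bar>\<Phi>\<^sup>T r\<bar>\<^sup>2 + \<bar>\<Lambda>\<^sup>-\<^sup>1 \<theta>\<bar>\<^sup>2)\<close> (\<open>tgp_mean_error_le\<close>). For the last two, the
  inequalities hold for each good design: \<open>\<bar>\<Phi>\<^sup>T r\<bar>\<^sup>2 \<le> (3 n / 2) \<bar>r\<bar>\<^sup>2\<close> since a matrix and its transpose
  have the same norm, and \<open>\<bar>\<Lambda>\<^sup>-\<^sup>1 \<theta>\<bar>\<^sup>2 \<le> (n / 4) \<Sum>\<^sub>j \<theta>\<^sub>j\<^sup>2 / \<lambda>\<^sub>j\<close> since \<open>\<Lambda>\<^sup>-\<^sup>1\<close> has norm below \<open>n / 4\<close>.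
  In expectation \<open>\<bar>r\<bar>\<^sup>2\<close> becomes \<open>n\<close> times the squared \<open>L\<^sup>2\<close> norm of the truncation error, and, by orthonormality of the eigenfunctions, \<open>\<bar>\<Phi>\<^sup>T \<epsilon>\<bar>\<^sup>2\<close> becomes
  \<open>\<sigma>\<^sup>2 n k\<close> (\<open>expected_error_terms\<close>).

  Measurability of the distance as a function of the data, or of the set of good designs, never comes
  up: the pointwise bound extends to a measurable function of all data, and the nonnegative integral,
  a supremum over simple functions below the integrand, is monotone for arbitrary integrands.
\<close>

section \<open>Gaussian integrals of quadratic forms\<close>

text \<open>
  The form \<open>x\<^sup>T A x\<close> on coordinate functions rather than on vectors, because these are the points
  over which the Gaussian densities are integrated.
\<close>

definition quad :: "real mat \<Rightarrow> nat \<Rightarrow> (nat \<Rightarrow> real) \<Rightarrow> real" where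
  "quad A k y = (\<Sum>i<k. \<Sum>j<k. A $$ (i, j) * y i * y j)"

definition pos_def :: "nat \<Rightarrow> real mat \<Rightarrow> bool" where
  "pos_def k A \<longleftrightarrow> A \<in> carrier_mat k k \<and> (\<forall>i<k. \<forall>j<k. A $$ (i, j) = A $$ (j, i)) \<and>
     (\<forall>y. (\<exists>i<k. y i \<noteq> 0) \<longrightarrow> 0 < quad A k y)"

definition schur_complement :: "nat \<Rightarrow> real mat \<Rightarrow> real mat" where
  "schur_complement k A = mat k k (\<lambda>(i, j). A $$ (i, j) - A $$ (i, k) * A $$ (k, j) / A $$ (k, k))"

text \<open>
  The one-dimensional step of the induction below: integrating out the last coordinate, whose form
  after completing the square is \<open>c (t - \<mu>)\<^sup>2\<close> plus the form \<open>r\<close> of the remaining coordinates. The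
  shape \<open>a + b q\<close> of the factor reproduces itself, with \<open>a\<close> replaced by \<open>a + b\<close>.
\<close>

lemma nn_integral_gauss_quadratic:
  fixes a b c r \<mu> :: real
  assumes "0 < c" "0 \<le> a" "0 \<le> b" "0 \<le> r"
  shows "(\<integral>\<^sup>+t. ennreal ((a + b * (c * (t - \<mu>)\<^sup>2 + r)) * exp (- (c * (t - \<mu>)\<^sup>2 + r) / 2)) \<partial>lborel) =
    ennreal (sqrt (2 * pi / c) * ((a + b + b * r) * exp (- r / 2)))"
proof -
  define s where "s = 1 / sqrt c"
  have s: "0 < s" "s\<^sup>2 = 1 / c" using assms by (auto simp: s_def power_divide)
  have "has_bochner_integral lborel (\<lambda>t. normal_density \<mu> s t * (t - \<mu>) ^ (2 * 0)) 1"
    using normal_moment_even[OF s(1), of \<mu> 0] by simp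
  moreover have "has_bochner_integral lborel (\<lambda>t. normal_density \<mu> s t * (t - \<mu>) ^ (2 * 1)) (1 / c)"
    using normal_moment_even[OF s(1), of \<mu> 1] s by (simp add: power_divide)
  ultimately have "has_bochner_integral lborel
      (\<lambda>t. (sqrt (2 * pi / c) * exp (- r / 2) * (a + b * r)) * (normal_density \<mu> s t * (t - \<mu>) ^ (2 * 0)) +
           (sqrt (2 * pi / c) * exp (- r / 2) * b * c) * (normal_density \<mu> s t * (t - \<mu>) ^ (2 * 1)))
      ((sqrt (2 * pi / c) * exp (- r / 2) * (a + b * r)) * 1 + (sqrt (2 * pi / c) * exp (- r / 2) * b * c) * (1 / c))"
    by (intro has_bochner_integral_add has_bochner_integral_mult_right)
  also have "(\<lambda>t. (sqrt (2 * pi / c) * exp (- r / 2) * (a + b * r)) * (normal_density \<mu> s t * (t - \<mu>) ^ (2 * 0)) +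
           (sqrt (2 * pi / c) * exp (- r / 2) * b * c) * (normal_density \<mu> s t * (t - \<mu>) ^ (2 * 1))) =
      (\<lambda>t. (a + b * (c * (t - \<mu>)\<^sup>2 + r)) * exp (- (c * (t - \<mu>)\<^sup>2 + r) / 2))"
  proof
    fix t
    define E F w u where "E = exp (- (c * (t - \<mu>)\<^sup>2) / 2)" and "F = exp (- r / 2)"
      and "w = sqrt (2 * pi / c)" and "u = (t - \<mu>)\<^sup>2"
    have 1: "normal_density \<mu> s t = E / w"
      using assms by (simp add: normal_density_def s E_def w_def)
    have 2: "exp (- (c * u + r) / 2) = E * F"
      by (simp add: E_def F_def u_def exp_add[symmetric] add_divide_distrib diff_divide_distrib)
    have 3: "w \<noteq> 0" using assms by (simp add: w_def)
    have 4: "(t - \<mu>) ^ (2 * 0) = 1" "(t - \<mu>) ^ (2 * 1) = u" by (simp_all add: u_def)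
    show "(sqrt (2 * pi / c) * exp (- r / 2) * (a + b * r)) * (normal_density \<mu> s t * (t - \<mu>) ^ (2 * 0)) +
           (sqrt (2 * pi / c) * exp (- r / 2) * b * c) * (normal_density \<mu> s t * (t - \<mu>) ^ (2 * 1)) =
      (a + b * (c * (t - \<mu>)\<^sup>2 + r)) * exp (- (c * (t - \<mu>)\<^sup>2 + r) / 2)"
      unfolding 4 u_def[symmetric] 1 2 unfolding w_def[symmetric] F_def[symmetric]
      using 3 by (simp add: algebra_simps)
  qed
  also have "(sqrt (2 * pi / c) * exp (- r / 2) * (a + b * r)) * 1 + (sqrt (2 * pi / c) * exp (- r / 2) * b * c) * (1 / c)
    = sqrt (2 * pi / c) * ((a + b + b * r) * exp (- r / 2))"
    using assms by (simp add: algebra_simps)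
  finally have I: "has_bochner_integral lborel
      (\<lambda>t. (a + b * (c * (t - \<mu>)\<^sup>2 + r)) * exp (- (c * (t - \<mu>)\<^sup>2 + r) / 2))
      (sqrt (2 * pi / c) * ((a + b + b * r) * exp (- r / 2)))" .
  have nn: "0 \<le> (a + b * (c * (t - \<mu>)\<^sup>2 + r)) * exp (- (c * (t - \<mu>)\<^sup>2 + r) / 2)" for t
    using assms by simp
  show ?thesis
    by (subst nn_integral_eq_integral) (use I nn in \<open>auto simp: has_bochner_integral_iff\<close>)
qed

text \<open>
  Completing the square in the last coordinate.
\<close>

lemma quad_Suc:
  assumes sym: "\<And>i j. i < Suc k \<Longrightarrow> j < Suc k \<Longrightarrow> A $$ (i, j) = A $$ (j, i)"
    and a: "A $$ (k, k) \<noteq> 0"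
  shows "quad A (Suc k) y =
    A $$ (k, k) * (y k + (\<Sum>i<k. A $$ (i, k) * y i) / A $$ (k, k))\<^sup>2 + quad (schur_complement k A) k y"
proof -
  define a where "a = A $$ (k, k)"
  define b where "b = (\<Sum>i<k. A $$ (i, k) * y i)"
  have b': "(\<Sum>j<k. A $$ (k, j) * y k * y j) = y k * b"
    unfolding b_def sum_distrib_left by (rule sum.cong) (auto simp: sym)
  have "quad A (Suc k) y = quad A k y + 2 * y k * b + a * (y k)\<^sup>2"
    by (simp add: quad_def sum.distrib b' a_def power2_eq_square)
      (simp add: b_def sum_distrib_left sum_distrib_right mult_ac)
  moreover have "quad (schur_complement k A) k y = quad A k y - b * b / a"
  proof -
    have "quad (schur_complement k A) k y =
      (\<Sum>i<k. \<Sum>j<k. A $$ (i, j) * y i * y j - (A $$ (i, k) * y i) * (A $$ (j, k) * y j) / a)"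
      unfolding quad_def by (intro sum.cong refl) (auto simp: schur_complement_def a_def sym algebra_simps)
    also have "\<dots> = quad A k y - (\<Sum>i<k. \<Sum>j<k. (A $$ (i, k) * y i) * (A $$ (j, k) * y j)) / a"
      by (simp add: quad_def sum_subtractf sum_divide_distrib)
    also have "(\<Sum>i<k. \<Sum>j<k. (A $$ (i, k) * y i) * (A $$ (j, k) * y j)) = b * b"
      unfolding b_def sum_product ..
    finally show ?thesis .
  qed
  moreover have "a * (y k + b / a)\<^sup>2 = a * (y k)\<^sup>2 + 2 * y k * b + b * b / a"
    using a by (simp add: a_def field_simps power2_eq_square)
  ultimately show ?thesis
    unfolding a_def[symmetric] b_def[symmetric] by simp
qed

text \<open>
  One step of block elimination: subtracting multiples of the last column clears the rest of the last
  row, and this column operation is multiplication by a unitriangular \<open>U\<close>.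
\<close>

lemma det_Suc_schur_complement:
  assumes A: "A \<in> carrier_mat (Suc k) (Suc k)" and a: "A $$ (k, k) \<noteq> 0"
  shows "det A = A $$ (k, k) * det (schur_complement k A)"
proof -
  define U where "U = four_block_mat (1\<^sub>m k) (0\<^sub>m k 1) (mat 1 k (\<lambda>(i, j). - A $$ (k, j) / A $$ (k, k))) (1\<^sub>m 1 :: real mat)"
  define V where "V = four_block_mat (schur_complement k A) (mat k 1 (\<lambda>(i, j). A $$ (i, k))) (0\<^sub>m 1 k) (mat 1 1 (\<lambda>_. A $$ (k, k)))"
  have U: "U \<in> carrier_mat (Suc k) (Suc k)" and V: "V \<in> carrier_mat (Suc k) (Suc k)"
    by (auto simp: U_def V_def schur_complement_def)
  have "det U = det (1\<^sub>m k) * det (1\<^sub>m 1 :: real mat)"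
    unfolding U_def by (rule det_four_block_mat_upper_right_zero) auto
  hence dU: "det U = 1" by simp
  have "det V = det (schur_complement k A) * det (mat 1 1 (\<lambda>_. A $$ (k, k)))"
    unfolding V_def by (rule det_four_block_mat_lower_left_zero) (auto simp: schur_complement_def)
  hence dV: "det V = A $$ (k, k) * det (schur_complement k A)"
    by (simp add: det_single)
  have "A * U = V"
  proof (rule eq_matI)
    fix i j assume ij: "i < dim_row V" "j < dim_col V"
    hence i: "i < Suc k" and j: "j < Suc k" using V by auto
    have "(A * U) $$ (i, j) = (\<Sum>l<Suc k. A $$ (i, l) * U $$ (l, j))"
      using A U i j by (simp add: scalar_prod_def atLeast0LessThan)
    also have "\<dots> = (\<Sum>l<k. A $$ (i, l) * (if l = j then 1 else 0)) + A $$ (i, k) * U $$ (k, j)"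
    proof -
      have "U $$ (l, j) = (if l = j then 1 else 0)" if "l < k" for l
        using that j by (auto simp: U_def)
      thus ?thesis by simp
    qed
    also have "\<dots> = V $$ (i, j)"
    proof -
      have 1: "(\<Sum>l<k. A $$ (i, l) * (if l = j then 1 else 0)) = (if j < k then A $$ (i, j) else 0)"
        by (subst sum.cong[OF refl, where h = "\<lambda>l. if l = j then A $$ (i, l) else 0"]) (auto simp: sum.delta')
      have 2: "U $$ (k, j) = (if j < k then - A $$ (k, j) / A $$ (k, k) else 1)"
        using j by (simp add: U_def)
      have 3: "V $$ (i, j) = (if i < k then if j < k then A $$ (i, j) - A $$ (i, k) * A $$ (k, j) / A $$ (k, k)
          else A $$ (i, k) else if j < k then 0 else A $$ (k, k))"
        using i j by (simp add: V_def schur_complement_def)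
      show ?thesis
        unfolding 1 2 3 using i j a by (cases "i < k"; cases "j < k") (auto simp: less_Suc_eq)
    qed
    finally show "(A * U) $$ (i, j) = V $$ (i, j)" .
  qed (use A U V in auto)
  thus ?thesis using det_mult[OF A U] dU dV by simp
qed

lemma pos_def_Suc:
  assumes "pos_def (Suc k) A"
  shows "0 < A $$ (k, k)" "pos_def k (schur_complement k A)"
proof -
  have sym: "\<And>i j. i < Suc k \<Longrightarrow> j < Suc k \<Longrightarrow> A $$ (i, j) = A $$ (j, i)"
    using assms by (auto simp: pos_def_def)
  have pos: "\<And>y. \<exists>i<Suc k. y i \<noteq> 0 \<Longrightarrow> 0 < quad A (Suc k) y"
    using assms by (auto simp: pos_def_def)
  have "quad A (Suc k) (\<lambda>i. if i = k then 1 else 0) = A $$ (k, k)"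
    by (simp add: quad_def sum.delta if_distrib cong: if_cong)
  thus a: "0 < A $$ (k, k)"
    using pos[of "\<lambda>i. if i = k then 1 else 0"] by auto
  show "pos_def k (schur_complement k A)"
    unfolding pos_def_def
  proof (intro conjI allI impI)
    show "schur_complement k A \<in> carrier_mat k k" by (simp add: schur_complement_def)
    show "\<And>i j. i < k \<Longrightarrow> j < k \<Longrightarrow> schur_complement k A $$ (i, j) = schur_complement k A $$ (j, i)"
      using sym by (simp add: schur_complement_def)
    fix y :: "nat \<Rightarrow> real" assume y: "\<exists>i<k. y i \<noteq> 0"
    \<comment> \<open>This last coordinate makes the completed square vanish.\<close>
    define z where "z = y(k := - (\<Sum>i<k. A $$ (i, k) * y i) / A $$ (k, k))"
    have "(\<Sum>i<k. A $$ (i, k) * z i) = (\<Sum>i<k. A $$ (i, k) * y i)"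
      by (rule sum.cong) (auto simp: z_def)
    hence "quad A (Suc k) z = quad (schur_complement k A) k z"
      using quad_Suc[OF sym, of k z] a by (simp add: z_def)
    also have "\<dots> = quad (schur_complement k A) k y"
      unfolding quad_def z_def by (intro sum.cong) auto
    finally have "quad A (Suc k) z = quad (schur_complement k A) k y" .
    moreover have "\<exists>i<Suc k. z i \<noteq> 0" using y by (auto simp: z_def intro: less_SucI)
    ultimately show "0 < quad (schur_complement k A) k y" using pos[of z] by simp
  qed
qed

lemma pos_def_det_pos: "pos_def k A \<Longrightarrow> 0 < det A"
proof (induction k arbitrary: A)
  case 0
  thus ?case by (simp add: pos_def_def det_dim_zero)
next
  case (Suc k)
  thus ?case using pos_def_Suc[OF Suc.prems] det_Suc_schur_complement[of A k]
    by (auto simp: pos_def_def)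
qed

lemma quad_nonneg: "pos_def k A \<Longrightarrow> 0 \<le> quad A k y"
proof (cases "\<exists>i<k. y i \<noteq> 0")
  case False
  thus ?thesis by (simp add: quad_def)
qed (auto simp: pos_def_def intro: less_imp_le)

text \<open>
  With \<open>(a, b) = (1, 0)\<close> this is the normalising constant of the density; with \<open>(a, b) = (0, 1)\<close> it says
  that \<open>x\<^sup>T A x\<close> has mean \<open>k\<close> under the Gaussian of precision \<open>A\<close>. Carrying both through one induction
  on the dimension avoids diagonalising \<open>A\<close>: each step splits off one coordinate and passes to the
  Schur complement.
\<close>

lemma nn_integral_gauss_quad:
  assumes "pos_def k A" "0 \<le> a" "0 \<le> b"
  shows "(\<integral>\<^sup>+x. ennreal ((a + b * quad A k (\<lambda>i. x i - m i)) * exp (- quad A k (\<lambda>i. x i - m i) / 2)) \<partial>euclid k) =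
    ennreal ((a + b * real k) * sqrt ((2 * pi) ^ k / det A))"
  using assms
proof (induction k arbitrary: A a b)
  case 0
  hence "det A = 1" by (auto simp: pos_def_def det_dim_zero)
  moreover have "emeasure (euclid 0) (space (euclid 0)) = 1"
    by (simp add: euclid_def PiM_empty)
  ultimately show ?case by (simp add: quad_def)
next
  case (Suc k)
  interpret product_sigma_finite "\<lambda>_. lborel :: real measure"
    by standard
  note pd = pos_def_Suc[OF Suc.prems(1)]
  let ?a = "A $$ (k, k)" and ?S = "schur_complement k A"
  have sym: "\<And>i j. i < Suc k \<Longrightarrow> j < Suc k \<Longrightarrow> A $$ (i, j) = A $$ (j, i)"
    using Suc.prems by (auto simp: pos_def_def)
  have [measurable]: "(\<lambda>x. quad B j (\<lambda>i. x i - m i)) \<in> borel_measurable (\<Pi>\<^sub>M i\<in>{..<j}. lborel)" for B j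
    unfolding quad_def by measurable
  have ins: "{..<Suc k} = insert k {..<k}" by auto
  have "(\<integral>\<^sup>+x. ennreal ((a + b * quad A (Suc k) (\<lambda>i. x i - m i)) * exp (- quad A (Suc k) (\<lambda>i. x i - m i) / 2)) \<partial>euclid (Suc k)) =
    (\<integral>\<^sup>+x. (\<integral>\<^sup>+t. ennreal ((a + b * quad A (Suc k) (\<lambda>i. (x(k := t)) i - m i)) * exp (- quad A (Suc k) (\<lambda>i. (x(k := t)) i - m i) / 2)) \<partial>lborel) \<partial>euclid k)"
    unfolding euclid_def ins
    by (rule product_nn_integral_insert) (auto simp: ins[symmetric])
  also have "\<dots> = (\<integral>\<^sup>+x. ennreal (sqrt (2 * pi / ?a)) *
      ennreal ((a + b + b * quad ?S k (\<lambda>i. x i - m i)) * exp (- quad ?S k (\<lambda>i. x i - m i) / 2)) \<partial>euclid k)"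
  proof (rule nn_integral_cong)
    fix x :: "nat \<Rightarrow> real"
    let ?r = "quad ?S k (\<lambda>i. x i - m i)"
    define \<mu> where "\<mu> = m k - (\<Sum>i<k. A $$ (i, k) * (x i - m i)) / ?a"
    have *: "quad A (Suc k) (\<lambda>i. (x(k := t)) i - m i) = ?a * (t - \<mu>)\<^sup>2 + ?r" for t
    proof -
      have "(\<Sum>i<k. A $$ (i, k) * ((x(k := t)) i - m i)) = (\<Sum>i<k. A $$ (i, k) * (x i - m i))"
        by (rule sum.cong) auto
      moreover have "quad ?S k (\<lambda>i. (x(k := t)) i - m i) = ?r"
        unfolding quad_def by (intro sum.cong) auto
      moreover have "(x(k := t)) k - m k + (\<Sum>i<k. A $$ (i, k) * (x i - m i)) / ?a = t - \<mu>"
        by (simp add: \<mu>_def)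
      moreover have "quad A (Suc k) (\<lambda>i. (x(k := t)) i - m i) =
          ?a * ((x(k := t)) k - m k + (\<Sum>i<k. A $$ (i, k) * ((x(k := t)) i - m i)) / ?a)\<^sup>2 +
          quad ?S k (\<lambda>i. (x(k := t)) i - m i)"
        by (rule quad_Suc[OF sym]) (use pd(1) in auto)
      ultimately show ?thesis by (simp only:)
    qed
    show "(\<integral>\<^sup>+t. ennreal ((a + b * quad A (Suc k) (\<lambda>i. (x(k := t)) i - m i)) * exp (- quad A (Suc k) (\<lambda>i. (x(k := t)) i - m i) / 2)) \<partial>lborel)
      = ennreal (sqrt (2 * pi / ?a)) * ennreal ((a + b + b * ?r) * exp (- ?r / 2))"
      unfolding * using nn_integral_gauss_quadratic[OF pd(1) Suc.prems(2,3) quad_nonneg[OF pd(2)]] pd(1)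
      by (simp add: ennreal_mult')
  qed
  also have "\<dots> = ennreal (sqrt (2 * pi / ?a)) * ennreal ((a + b + b * real k) * sqrt ((2 * pi) ^ k / det ?S))"
  proof (subst nn_integral_cmult)
    show "(\<lambda>x. ennreal ((a + b + b * quad ?S k (\<lambda>i. x i - m i)) * exp (- quad ?S k (\<lambda>i. x i - m i) / 2)))
        \<in> borel_measurable (euclid k)"
      unfolding euclid_def by measurable
    have "(\<integral>\<^sup>+x. ennreal ((a + b + b * quad ?S k (\<lambda>i. x i - m i)) * exp (- quad ?S k (\<lambda>i. x i - m i) / 2)) \<partial>euclid k) =
        ennreal ((a + b + b * real k) * sqrt ((2 * pi) ^ k / det ?S))"
      by (rule Suc.IH[OF pd(2)]) (use Suc.prems in auto)
    thus "ennreal (sqrt (2 * pi / ?a)) * (\<integral>\<^sup>+x. ennreal ((a + b + b * quad ?S k (\<lambda>i. x i - m i)) * exp (- quad ?S k (\<lambda>i. x i - m i) / 2)) \<partial>euclid k) =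
      ennreal (sqrt (2 * pi / ?a)) * ennreal ((a + b + b * real k) * sqrt ((2 * pi) ^ k / det ?S))"
      by (rule arg_cong)
  qed
  also have "\<dots> = ennreal ((a + b * real (Suc k)) * sqrt ((2 * pi) ^ Suc k / det A))"
  proof -
    have "det A = ?a * det ?S"
      using det_Suc_schur_complement[of A k] Suc.prems pd(1) by (auto simp: pos_def_def)
    hence "sqrt ((2 * pi) ^ Suc k / det A) = sqrt (2 * pi / ?a * ((2 * pi) ^ k / det ?S))"
      by (simp only: power_Suc times_divide_times_eq)
    also have "\<dots> = sqrt (2 * pi / ?a) * sqrt ((2 * pi) ^ k / det ?S)"
      by (rule real_sqrt_mult)
    finally have 1: "sqrt ((2 * pi) ^ Suc k / det A) = sqrt (2 * pi / ?a) * sqrt ((2 * pi) ^ k / det ?S)" .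
    have 2: "a + b * real (Suc k) = a + b + b * real k" by (simp add: algebra_simps)
    have 3: "0 \<le> sqrt (2 * pi / ?a)" using pd(1) by simp
    show ?thesis unfolding 1 2 ennreal_mult'[OF 3, symmetric] by (simp only: mult_ac)
  qed
  finally show ?case .
qed

section \<open>Gaussian measures and their Wasserstein distance\<close>

lemma scalar_prod_mult_mat_vec:
  assumes "A \<in> carrier_mat k k" "v \<in> carrier_vec k"
  shows "v \<bullet> (A *\<^sub>v v) = quad A k (\<lambda>i. v $ i)"
  using assms by (auto simp: scalar_prod_def quad_def atLeast0LessThan sum_distrib_left mult_ac intro!: sum.cong)

lemma mat_inv_eqI:
  assumes A: "A \<in> carrier_mat n n" and B: "B \<in> carrier_mat n n" and AB: "A * B = 1\<^sub>m n"
  shows "mat_inv A = B"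
proof -
  have "det A * det B = 1" using det_mult[OF A B] AB by simp
  hence "det A \<noteq> 0" by auto
  from det_non_zero_imp_unit[OF A this, where b = "()"] mat_inverse(1)[OF A, where b = "()"] obtain C where C: "mat_inverse A = Some C"
    by (cases "mat_inverse A") auto
  from mat_inverse(2)[OF A C] have CA: "C * A = 1\<^sub>m n" "C \<in> carrier_mat n n" by auto
  have "C = C * (A * B)" using CA AB by simp
  also have "\<dots> = B" using CA A B by (simp add: assoc_mult_mat[symmetric])
  finally show ?thesis using C by (simp add: mat_inv_def)
qed

lemma mat_mult_mat_inv:
  assumes A: "A \<in> carrier_mat n n" and d: "det A \<noteq> 0"
  shows "mat_inv A \<in> carrier_mat n n" "A * mat_inv A = 1\<^sub>m n"
proof -
  from det_non_zero_imp_unit[OF A d, where b = "()"] mat_inverse(1)[OF A, where b = "()"] obtain C where C: "mat_inverse A = Some C"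
    by (cases "mat_inverse A") auto
  from mat_inverse(2)[OF A C] C show "mat_inv A \<in> carrier_mat n n" "A * mat_inv A = 1\<^sub>m n"
    by (auto simp: mat_inv_def)
qed

lemma sets_gaussian [simp]: "sets (gaussian m S) = sets (euclid (dim_vec m))"
  by (simp add: gaussian_def)

text \<open>
  The trace of the covariance \<open>A\<^sup>-\<^sup>1\<close> need not be computed: if \<open>c \<bar>x\<bar>\<^sup>2 \<le> x\<^sup>T A x\<close>, then the second moment
  is at most \<open>1 / c\<close> times the mean of \<open>x\<^sup>T A x\<close>, which is \<open>k\<close>.
\<close>

lemma
  assumes m: "m \<in> carrier_vec k" and S: "S \<in> carrier_mat k k"
    and A: "pos_def k A" and SA: "S * A = 1\<^sub>m k"
    and c: "0 < c" "\<And>y. c * (\<Sum>i<k. (y i)\<^sup>2) \<le> quad A k y"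
  shows prob_space_gaussian: "prob_space (gaussian m S)"
    and gaussian_second_moment_le:
      "(\<integral>\<^sup>+x. ennreal (\<Sum>i<k. (x i - m $ i)\<^sup>2) \<partial>gaussian m S) \<le> ennreal (real k / c)"
proof -
  have A': "A \<in> carrier_mat k k" using A by (simp add: pos_def_def)
  have inv: "mat_inv S = A" by (rule mat_inv_eqI[OF S A' SA])
  have "det S * det A = 1" using det_mult[OF S A'] SA by simp
  hence detS: "det S = 1 / det A" using pos_def_det_pos[OF A] by (simp add: field_simps)
  define q where "q x = quad A k (\<lambda>i. x i - m $ i)" for x
  define Z where "Z = sqrt ((2 * pi) ^ k / det A)"
  have Z: "0 < Z" using pos_def_det_pos[OF A] by (simp add: Z_def)
  have [measurable]: "q \<in> borel_measurable (euclid k)"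
    unfolding q_def quad_def euclid_def by measurable
  have [measurable]: "(\<lambda>x. \<Sum>i<k. (x i - m $ i)\<^sup>2) \<in> borel_measurable (euclid k)"
    unfolding euclid_def by measurable
  have G: "gaussian m S = density (euclid k) (\<lambda>x. ennreal (exp (- q x / 2) / Z))"
  proof -
    have "(vec k x - m) \<bullet> (A *\<^sub>v (vec k x - m)) = q x" for x
    proof -
      have "(vec k x - m) \<bullet> (A *\<^sub>v (vec k x - m)) = quad A k (\<lambda>i. (vec k x - m) $ i)"
        by (rule scalar_prod_mult_mat_vec[OF A']) (use m in auto)
      also have "\<dots> = q x" unfolding q_def quad_def using m by (intro sum.cong) auto
      finally show ?thesis .
    qed
    thus ?thesis using m by (simp add: gaussian_def Let_def inv detS Z_def)
  qed
  have I: "(\<integral>\<^sup>+x. ennreal ((a + b * q x) * exp (- q x / 2)) \<partial>euclid k) = ennreal ((a + b * real k) * Z)"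
    if "0 \<le> a" "0 \<le> b" for a b
    unfolding q_def Z_def by (rule nn_integral_gauss_quad[OF A that])
  show "prob_space (gaussian m S)"
  proof (rule prob_spaceI)
    have "emeasure (gaussian m S) (space (gaussian m S)) = (\<integral>\<^sup>+x. ennreal (exp (- q x / 2) / Z) \<partial>euclid k)"
      unfolding G by (simp add: emeasure_density cong: nn_integral_cong)
    also have "\<dots> = (\<integral>\<^sup>+x. ennreal (1 / Z) * ennreal ((1 + 0 * q x) * exp (- q x / 2)) \<partial>euclid k)"
      using Z by (intro nn_integral_cong) (simp add: ennreal_mult'[symmetric])
    also have "\<dots> = ennreal (1 / Z) * ennreal ((1 + 0 * real k) * Z)"
      by (subst nn_integral_cmult) (simp_all only: I zero_le_one order.refl, measurable)
    also have "\<dots> = 1" using Z by (simp add: ennreal_mult'[symmetric])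
    finally show "emeasure (gaussian m S) (space (gaussian m S)) = 1" .
  qed
  have "(\<integral>\<^sup>+x. ennreal (\<Sum>i<k. (x i - m $ i)\<^sup>2) \<partial>gaussian m S) =
      (\<integral>\<^sup>+x. ennreal (exp (- q x / 2) / Z) * ennreal (\<Sum>i<k. (x i - m $ i)\<^sup>2) \<partial>euclid k)"
    unfolding G by (subst nn_integral_density) auto
  also have "\<dots> \<le> (\<integral>\<^sup>+x. ennreal (1 / (c * Z)) * ennreal ((0 + 1 * q x) * exp (- q x / 2)) \<partial>euclid k)"
  proof (rule nn_integral_mono)
    fix x
    have "(\<Sum>i<k. (x i - m $ i)\<^sup>2) \<le> q x / c"
      using c(2)[of "\<lambda>i. x i - m $ i"] c(1) by (simp add: q_def field_simps)
    hence "exp (- q x / 2) / Z * (\<Sum>i<k. (x i - m $ i)\<^sup>2) \<le> exp (- q x / 2) / Z * (q x / c)"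
      using Z by (intro mult_left_mono) auto
    also have "\<dots> = 1 / (c * Z) * ((0 + 1 * q x) * exp (- q x / 2))" by (simp add: mult_ac)
    finally show "ennreal (exp (- q x / 2) / Z) * ennreal (\<Sum>i<k. (x i - m $ i)\<^sup>2)
        \<le> ennreal (1 / (c * Z)) * ennreal ((0 + 1 * q x) * exp (- q x / 2))"
      using Z c(1) by (subst (1 2) ennreal_mult'[symmetric]) (auto intro!: ennreal_leI)
  qed
  also have "\<dots> = ennreal (1 / (c * Z)) * ennreal ((0 + 1 * real k) * Z)"
    by (subst nn_integral_cmult) (simp_all only: I zero_le_one order.refl, measurable)
  also have "\<dots> = ennreal (real k / c)" using Z c(1) by (simp add: ennreal_mult'[symmetric])
  finally show "(\<integral>\<^sup>+x. ennreal (\<Sum>i<k. (x i - m $ i)\<^sup>2) \<partial>gaussian m S) \<le> ennreal (real k / c)" .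
qed

lemma ennreal_sqrt_square: "(ennreal_sqrt x)\<^sup>2 = x"
  by (cases x) (auto simp: ennreal_sqrt_def ennreal_power enn2real_ennreal)

lemma pair_measure_in_couplings:
  assumes "prob_space P" "prob_space Q"
  shows "P \<Otimes>\<^sub>M Q \<in> couplings P Q"
proof -
  interpret P: prob_space P by fact
  interpret Q: prob_space Q by fact
  have "distr (P \<Otimes>\<^sub>M Q) P fst = P"
    by (rule Q.distr_pair_fst)
  moreover have "distr (P \<Otimes>\<^sub>M Q) Q snd = Q"
  proof (rule measure_eqI)
    fix A assume "A \<in> sets (distr (P \<Otimes>\<^sub>M Q) Q snd)"
    hence A: "A \<in> sets Q" by simp
    have "snd -` A \<inter> space (P \<Otimes>\<^sub>M Q) = space P \<times> A"
      using sets.sets_into_space[OF A] by (auto simp: space_pair_measure)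
    thus "emeasure (distr (P \<Otimes>\<^sub>M Q) Q snd) A = emeasure Q A"
      using A by (simp add: emeasure_distr Q.emeasure_pair_measure_Times P.emeasure_space_1)
  qed simp
  ultimately show ?thesis by (simp add: couplings_def)
qed

lemma three_term_square_le: "(a + b + c)\<^sup>2 \<le> 3 * (a\<^sup>2 + b\<^sup>2 + c\<^sup>2 :: real)"
proof -
  have "0 \<le> (a - b)\<^sup>2 + (b - c)\<^sup>2 + (a - c)\<^sup>2" by simp
  thus ?thesis by (simp add: power2_eq_square algebra_simps)
qed

text \<open>
  The cost of the independent coupling. The centres \<open>a\<close> and \<open>b\<close> are arbitrary here, so no first moments
  enter; the price is the factor \<open>3\<close>.
\<close>

lemma wasserstein2_square_le:
  assumes P: "prob_space P" "sets P = sets (euclid k)" and Q: "prob_space Q" "sets Q = sets (euclid k)"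
    and p: "(\<integral>\<^sup>+u. ennreal (\<Sum>i<k. (u i - a i)\<^sup>2) \<partial>P) \<le> ennreal p" "0 \<le> p"
    and q: "(\<integral>\<^sup>+v. ennreal (\<Sum>i<k. (v i - b i)\<^sup>2) \<partial>Q) \<le> ennreal q" "0 \<le> q"
  shows "(wasserstein2 k P Q)\<^sup>2 \<le> ennreal (3 * (p + (\<Sum>i<k. (a i - b i)\<^sup>2) + q))"
proof -
  let ?J = "P \<Otimes>\<^sub>M Q"
  have J: "?J \<in> couplings P Q" by (rule pair_measure_in_couplings) fact+
  hence fst: "distr ?J P fst = P" and snd: "distr ?J Q snd = Q" by (auto simp: couplings_def)
  interpret P: prob_space P by fact
  interpret Q: prob_space Q by fact
  interpret J: pair_prob_space P Q ..
  have coord: "(\<lambda>u. u i) \<in> borel_measurable M" if "i < k" "sets M = sets (euclid k)" for i and M :: "(nat \<Rightarrow> real) measure"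
  proof -
    have "(\<lambda>u. u i) \<in> euclid k \<rightarrow>\<^sub>M lborel"
      unfolding euclid_def by (rule measurable_component_singleton) (use that in simp)
    thus ?thesis using that(2) by (simp cong: measurable_cong_sets)
  qed
  have [measurable]: "(\<lambda>u. \<Sum>i<k. (u i - a i)\<^sup>2) \<in> borel_measurable P" "(\<lambda>u. \<Sum>i<k. (u i - b i)\<^sup>2) \<in> borel_measurable Q"
    by (auto intro!: borel_measurable_sum borel_measurable_power borel_measurable_diff coord P Q)
  let ?d = "\<Sum>i<k. (a i - b i)\<^sup>2"
  have "(wasserstein2 k P Q)\<^sup>2 \<le> (ennreal_sqrt (\<integral>\<^sup>+(u, v). ennreal (\<Sum>i<k. (u i - v i)\<^sup>2) \<partial>?J))\<^sup>2"
    unfolding wasserstein2_def by (intro power_mono INF_lower J) auto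
  also have "\<dots> = (\<integral>\<^sup>+(u, v). ennreal (\<Sum>i<k. (u i - v i)\<^sup>2) \<partial>?J)"
    by (rule ennreal_sqrt_square)
  also have "\<dots> \<le> (\<integral>\<^sup>+w. ennreal 3 * (ennreal (\<Sum>i<k. (fst w i - a i)\<^sup>2) + ennreal ?d + ennreal (\<Sum>i<k. (snd w i - b i)\<^sup>2)) \<partial>?J)"
  proof (rule nn_integral_mono)
    fix w :: "(nat \<Rightarrow> real) \<times> (nat \<Rightarrow> real)"
    obtain u v where w: "w = (u, v)" by (cases w)
    have "(u i - v i)\<^sup>2 \<le> 3 * ((u i - a i)\<^sup>2 + (a i - b i)\<^sup>2 + (v i - b i)\<^sup>2)" for i
      using three_term_square_le[of "u i - a i" "a i - b i" "b i - v i"] by (simp add: power2_commute)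
    hence "(\<Sum>i<k. (u i - v i)\<^sup>2) \<le> (\<Sum>i<k. 3 * ((u i - a i)\<^sup>2 + (a i - b i)\<^sup>2 + (v i - b i)\<^sup>2))"
      by (rule sum_mono)
    also have "\<dots> = 3 * ((\<Sum>i<k. (u i - a i)\<^sup>2) + ?d + (\<Sum>i<k. (v i - b i)\<^sup>2))"
      by (simp add: sum_distrib_left sum.distrib)
    finally have "ennreal (\<Sum>i<k. (u i - v i)\<^sup>2) \<le> ennreal (3 * ((\<Sum>i<k. (u i - a i)\<^sup>2) + ?d + (\<Sum>i<k. (v i - b i)\<^sup>2)))"
      by (rule ennreal_leI)
    also have "\<dots> = ennreal 3 * (ennreal (\<Sum>i<k. (u i - a i)\<^sup>2) + ennreal ?d + ennreal (\<Sum>i<k. (v i - b i)\<^sup>2))"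
      by (subst ennreal_mult) (auto simp: sum_nonneg ennreal_plus)
    finally show "(case w of (u, v) \<Rightarrow> ennreal (\<Sum>i<k. (u i - v i)\<^sup>2)) \<le> ennreal 3 * (ennreal (\<Sum>i<k. (fst w i - a i)\<^sup>2) + ennreal ?d + ennreal (\<Sum>i<k. (snd w i - b i)\<^sup>2))"
      by (simp add: w)
  qed
  also have "\<dots> = ennreal 3 * ((\<integral>\<^sup>+w. ennreal (\<Sum>i<k. (fst w i - a i)\<^sup>2) \<partial>?J) + ennreal ?d + (\<integral>\<^sup>+w. ennreal (\<Sum>i<k. (snd w i - b i)\<^sup>2) \<partial>?J))"
    by (subst nn_integral_cmult, measurable, subst nn_integral_add, measurable, subst nn_integral_add, measurable)
      (simp add: J.emeasure_space_1)
  also have "(\<integral>\<^sup>+w. ennreal (\<Sum>i<k. (fst w i - a i)\<^sup>2) \<partial>?J) = (\<integral>\<^sup>+u. ennreal (\<Sum>i<k. (u i - a i)\<^sup>2) \<partial>distr ?J P fst)"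
    by (rule nn_integral_distr[symmetric]) measurable
  also have "(\<integral>\<^sup>+w. ennreal (\<Sum>i<k. (snd w i - b i)\<^sup>2) \<partial>?J) = (\<integral>\<^sup>+v. ennreal (\<Sum>i<k. (v i - b i)\<^sup>2) \<partial>distr ?J Q snd)"
    by (rule nn_integral_distr[symmetric]) measurable
  also have "ennreal 3 * ((\<integral>\<^sup>+u. ennreal (\<Sum>i<k. (u i - a i)\<^sup>2) \<partial>distr ?J P fst) + ennreal ?d + (\<integral>\<^sup>+v. ennreal (\<Sum>i<k. (v i - b i)\<^sup>2) \<partial>distr ?J Q snd))
      \<le> ennreal 3 * (ennreal p + ennreal ?d + ennreal q)"
    unfolding fst snd by (intro mult_left_mono add_mono p q order.refl) auto
  also have "\<dots> = ennreal (3 * (p + ?d + q))"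
    using p(2) q(2) by (simp add: ennreal_mult ennreal_plus sum_nonneg)
  finally show ?thesis .
qed

section \<open>Operator norm and good designs\<close>

lemma mult_mat_vec_index:
  assumes "A \<in> carrier_mat n k" "v \<in> carrier_vec k" "i < n"
  shows "(A *\<^sub>v v) $ i = (\<Sum>j<k. A $$ (i, j) * v $ j)"
  using assms by (auto simp: scalar_prod_def atLeast0LessThan intro!: sum.cong)

lemma vec_norm2_square: "v \<in> carrier_vec k \<Longrightarrow> (vec_norm2 v)\<^sup>2 = (\<Sum>i<k. (v $ i)\<^sup>2)"
  by (simp add: vec_norm2_def scalar_prod_def atLeast0LessThan power2_eq_square sum_nonneg)

lemma vec_norm2_nonneg: "0 \<le> vec_norm2 v"
  by (simp add: vec_norm2_def scalar_prod_def sum_nonneg)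

text \<open>
  The supremum in \<open>op_norm\<close> is a real one and says nothing unless the set is bounded; the Frobenius
  norm bounds it.
\<close>

lemma vec_norm2_le_op_norm:
  assumes B: "B \<in> carrier_mat n k" and v: "v \<in> carrier_vec k" "vec_norm2 v \<le> 1"
  shows "vec_norm2 (B *\<^sub>v v) \<le> op_norm B"
proof -
  define F where "F = (\<Sum>i<n. \<Sum>j<k. (B $$ (i, j))\<^sup>2)"
  have "vec_norm2 (B *\<^sub>v u) \<le> sqrt F" if u: "u \<in> carrier_vec k" "vec_norm2 u \<le> 1" for u
  proof (rule real_le_rsqrt)
    have u1: "(\<Sum>j<k. (u $ j)\<^sup>2) \<le> 1"
      using u vec_norm2_nonneg[of u] by (simp add: vec_norm2_square[symmetric] power_le_one)
    have "(vec_norm2 (B *\<^sub>v u))\<^sup>2 = (\<Sum>i<n. (\<Sum>j<k. B $$ (i, j) * u $ j)\<^sup>2)"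
      using B u by (subst vec_norm2_square[of _ n]) (auto simp: mult_mat_vec_index[OF B] simp del: index_mult_mat_vec)
    also have "\<dots> \<le> (\<Sum>i<n. (\<Sum>j<k. (B $$ (i, j))\<^sup>2) * (\<Sum>j<k. (u $ j)\<^sup>2))"
      by (intro sum_mono Cauchy_Schwarz_ineq_sum)
    also have "\<dots> \<le> (\<Sum>i<n. (\<Sum>j<k. (B $$ (i, j))\<^sup>2) * 1)"
      by (intro sum_mono mult_left_mono u1 sum_nonneg) auto
    finally show "(vec_norm2 (B *\<^sub>v u))\<^sup>2 \<le> F" by (simp add: F_def)
  qed
  hence "bdd_above {vec_norm2 (B *\<^sub>v u) | u. u \<in> carrier_vec (dim_col B) \<and> vec_norm2 u \<le> 1}"
    using B by (intro bdd_aboveI[of _ "sqrt F"]) auto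
  thus ?thesis
    unfolding op_norm_def using B v by (intro cSup_upper) auto
qed

lemma abs_quad_le_op_norm:
  assumes B: "B \<in> carrier_mat k k"
  shows "\<bar>quad B k y\<bar> \<le> op_norm B * (\<Sum>i<k. (y i)\<^sup>2)"
proof (cases "(\<Sum>i<k. (y i)\<^sup>2) = 0")
  case True
  hence "\<forall>i<k. y i = 0" by (simp add: sum_nonneg_eq_0_iff)
  thus ?thesis by (simp add: quad_def)
next
  case False
  define s where "s = (\<Sum>i<k. (y i)\<^sup>2)"
  have s: "0 < s" using False by (simp add: s_def sum_nonneg less_le)
  define u where "u = vec k (\<lambda>i. y i / sqrt s)"
  have u: "u \<in> carrier_vec k" by (simp add: u_def)
  have u1: "(\<Sum>i<k. (u $ i)\<^sup>2) = 1"
    using s by (simp add: u_def power_divide sum_divide_distrib[symmetric] s_def[symmetric])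
  have "(vec_norm2 u)\<^sup>2 = 1" using u u1 by (simp add: vec_norm2_square)
  hence n1: "vec_norm2 u \<le> 1" using vec_norm2_nonneg[of u] by (simp add: power2_eq_1_iff)
  have Bu: "B *\<^sub>v u \<in> carrier_vec k" using B u by (rule mult_mat_vec_carrier)
  have "(u \<bullet> (B *\<^sub>v u))\<^sup>2 = (\<Sum>i<k. u $ i * (B *\<^sub>v u) $ i)\<^sup>2"
    using B by (simp add: scalar_prod_def atLeast0LessThan)
  also have "\<dots> \<le> (\<Sum>i<k. (u $ i)\<^sup>2) * (\<Sum>i<k. ((B *\<^sub>v u) $ i)\<^sup>2)"
    by (rule Cauchy_Schwarz_ineq_sum)
  also have "\<dots> = (vec_norm2 (B *\<^sub>v u))\<^sup>2" unfolding u1 vec_norm2_square[OF Bu] by simp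
  finally have "\<bar>u \<bullet> (B *\<^sub>v u)\<bar> \<le> vec_norm2 (B *\<^sub>v u)"
    using vec_norm2_nonneg by (metis abs_le_square_iff abs_of_nonneg)
  also have "\<dots> \<le> op_norm B" by (rule vec_norm2_le_op_norm[OF B u n1])
  finally have "\<bar>quad B k (\<lambda>i. u $ i)\<bar> \<le> op_norm B"
    using scalar_prod_mult_mat_vec[OF B u] by simp
  moreover have "quad B k y = s * quad B k (\<lambda>i. u $ i)"
  proof -
    have "B $$ (i, j) * y i * y j = s * (B $$ (i, j) * (y i / sqrt s) * (y j / sqrt s))" for i j
    proof -
      have "s * (B $$ (i, j) * (y i / sqrt s) * (y j / sqrt s)) = B $$ (i, j) * y i * y j * (s / (sqrt s * sqrt s))"
        by simp
      thus ?thesis using s by simp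
    qed
    thus ?thesis unfolding quad_def sum_distrib_left by (intro sum.cong) (auto simp: u_def)
  qed
  ultimately show ?thesis
    using s by (simp add: abs_mult s_def[symmetric] mult_left_mono mult.commute)
qed

lemma gram_carrier [simp]: "gram \<phi> n k X \<in> carrier_mat k k"
  unfolding gram_def by (rule mult_carrier_mat[of _ k n]) (simp_all add: design_def)

lemma gram_index: "i < k \<Longrightarrow> j < k \<Longrightarrow> gram \<phi> n k X $$ (i, j) = (\<Sum>l<n. \<phi> i (X l) * \<phi> j (X l))"
  by (simp add: gram_def design_def scalar_prod_def atLeast0LessThan)

lemma quad_gram: "quad (gram \<phi> n k X) k y = (\<Sum>l<n. (\<Sum>j<k. \<phi> j (X l) * y j)\<^sup>2)"
proof -
  have "quad (gram \<phi> n k X) k y = (\<Sum>i<k. \<Sum>j<k. \<Sum>l<n. (\<phi> i (X l) * y i) * (\<phi> j (X l) * y j))"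
    unfolding quad_def by (intro sum.cong refl) (simp add: gram_index sum_distrib_left sum_distrib_right mult_ac)
  also have "\<dots> = (\<Sum>i<k. \<Sum>l<n. \<Sum>j<k. (\<phi> i (X l) * y i) * (\<phi> j (X l) * y j))"
    by (intro sum.cong refl sum.swap)
  also have "\<dots> = (\<Sum>l<n. \<Sum>i<k. \<Sum>j<k. (\<phi> i (X l) * y i) * (\<phi> j (X l) * y j))"
    by (rule sum.swap)
  finally show ?thesis by (simp add: power2_eq_square sum_product)
qed

lemma quad_minus_smult_one:
  assumes "A \<in> carrier_mat k k"
  shows "quad (A - c \<cdot>\<^sub>m 1\<^sub>m k) k y = quad A k y - c * (\<Sum>i<k. (y i)\<^sup>2)"
proof -
  have "quad (A - c \<cdot>\<^sub>m 1\<^sub>m k) k y = (\<Sum>i<k. \<Sum>j<k. A $$ (i, j) * y i * y j - (if j = i then c * (y i)\<^sup>2 else 0))"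
    unfolding quad_def using assms
    by (intro sum.cong refl) (auto simp: algebra_simps power2_eq_square)
  thus ?thesis by (simp add: sum_subtractf quad_def sum_distrib_left)
qed

lemma good_design_sandwich:
  assumes "X \<in> good_designs D \<phi> n k"
  shows "real n / 2 * (\<Sum>i<k. (y i)\<^sup>2) \<le> (\<Sum>l<n. (\<Sum>j<k. \<phi> j (X l) * y j)\<^sup>2)"
    and "(\<Sum>l<n. (\<Sum>j<k. \<phi> j (X l) * y j)\<^sup>2) \<le> 3 * real n / 2 * (\<Sum>i<k. (y i)\<^sup>2)"
proof -
  let ?s = "\<Sum>i<k. (y i)\<^sup>2" and ?B = "gram \<phi> n k X - real n \<cdot>\<^sub>m 1\<^sub>m k"
  have "\<bar>quad ?B k y\<bar> \<le> op_norm ?B * ?s"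
    by (rule abs_quad_le_op_norm) auto
  also have "\<dots> \<le> real n / 2 * ?s"
    using assms by (intro mult_right_mono sum_nonneg) (auto simp: good_designs_def)
  finally have "\<bar>(\<Sum>l<n. (\<Sum>j<k. \<phi> j (X l) * y j)\<^sup>2) - real n * ?s\<bar> \<le> real n / 2 * ?s"
    by (simp add: quad_minus_smult_one quad_gram)
  from this[unfolded abs_le_iff] show "real n / 2 * ?s \<le> (\<Sum>l<n. (\<Sum>j<k. \<phi> j (X l) * y j)\<^sup>2)"
    "(\<Sum>l<n. (\<Sum>j<k. \<phi> j (X l) * y j)\<^sup>2) \<le> 3 * real n / 2 * ?s"
    by (auto simp: field_simps)
qed

text \<open>
  A matrix and its transpose have the same operator norm, in squared form: with \<open>w = a\<^sup>T r\<close>, the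
  Cauchy-Schwarz inequality gives \<open>\<bar>w\<bar>\<^sup>4 = (r \<cdot> a w)\<^sup>2 \<le> \<bar>r\<bar>\<^sup>2 c \<bar>w\<bar>\<^sup>2\<close>.
\<close>

lemma adjoint_square_le:
  fixes a :: "nat \<Rightarrow> nat \<Rightarrow> real"
  assumes c: "0 \<le> c" and le: "\<And>y. (\<Sum>l<n. (\<Sum>j<k. a l j * y j)\<^sup>2) \<le> c * (\<Sum>j<k. (y j)\<^sup>2)"
  shows "(\<Sum>j<k. (\<Sum>l<n. a l j * r l)\<^sup>2) \<le> c * (\<Sum>l<n. (r l)\<^sup>2)"
proof -
  define w where "w j = (\<Sum>l<n. a l j * r l)" for j
  define W where "W = (\<Sum>j<k. (w j)\<^sup>2)"
  have W: "W = (\<Sum>l<n. r l * (\<Sum>j<k. a l j * w j))"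
  proof -
    have "W = (\<Sum>j<k. \<Sum>l<n. r l * (a l j * w j))"
      unfolding W_def power2_eq_square
      by (subst (1) w_def) (simp add: sum_distrib_left sum_distrib_right mult_ac)
    also have "\<dots> = (\<Sum>l<n. \<Sum>j<k. r l * (a l j * w j))" by (rule sum.swap)
    finally show ?thesis by (simp add: sum_distrib_left)
  qed
  have "W\<^sup>2 \<le> (\<Sum>l<n. (r l)\<^sup>2) * (\<Sum>l<n. (\<Sum>j<k. a l j * w j)\<^sup>2)"
    unfolding W by (rule Cauchy_Schwarz_ineq_sum)
  also have "\<dots> \<le> (\<Sum>l<n. (r l)\<^sup>2) * (c * W)"
    unfolding W_def by (intro mult_left_mono le sum_nonneg) auto
  finally have *: "W * W \<le> (c * (\<Sum>l<n. (r l)\<^sup>2)) * W" by (simp add: power2_eq_square mult_ac)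
  have W0: "0 \<le> W" by (simp add: W_def sum_nonneg)
  have "W \<le> c * (\<Sum>l<n. (r l)\<^sup>2)"
  proof (cases "W = 0")
    case False
    with W0 * show ?thesis by (simp add: mult_le_cancel_right)
  next
    case True
    thus ?thesis using c by (simp add: sum_nonneg)
  qed
  thus ?thesis by (simp add: W_def w_def)
qed

section \<open>Mean and covariance of the posterior on good designs\<close>

lemma
  assumes lam: "\<And>j. 0 \<le> lam j" and inv: "invertible_mat (Lambda lam k)"
  shows Lambda_eigenvalue_pos: "j < k \<Longrightarrow> 0 < lam j"
    and mat_inv_Lambda: "mat_inv (Lambda lam k) = mat_diag k (\<lambda>j. 1 / lam j)"
proof -
  have C: "Lambda lam k \<in> carrier_mat k k" by (simp add: Lambda_def)
  obtain B where B: "Lambda lam k * B = 1\<^sub>m k" "B * Lambda lam k = 1\<^sub>m (dim_row B)"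
    using inv C by (auto simp: invertible_mat_def inverts_mat_def)
  have "dim_col (Lambda lam k * B) = k" "dim_col (B * Lambda lam k) = dim_row B"
    unfolding B by simp_all
  hence Bc: "B \<in> carrier_mat k k" using C by (intro carrier_matI) auto
  show pos: "0 < lam j" if "j < k" for j
  proof -
    have "(Lambda lam k * B) $$ (j, j) = lam j * B $$ (j, j)"
      using that Bc unfolding Lambda_def by (subst mat_diag_mult_left[OF Bc]) simp
    hence "lam j \<noteq> 0" using B(1) that by auto
    thus ?thesis using lam[of j] by simp
  qed
  have "Lambda lam k * mat_diag k (\<lambda>j. 1 / lam j) = mat_diag k (\<lambda>j. lam j * (1 / lam j))"
    by (simp only: Lambda_def mat_diag_diag)
  also have "\<dots> = 1\<^sub>m k"
    by (intro eq_matI) (auto simp: mat_diag_def pos[THEN less_imp_neq, THEN not_sym])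
  finally show "mat_inv (Lambda lam k) = mat_diag k (\<lambda>j. 1 / lam j)"
    by (intro mat_inv_eqI[OF C]) auto
qed

lemma quad_mat_diag: "quad (mat_diag k f) k y = (\<Sum>i<k. f i * (y i)\<^sup>2)"
proof -
  have "quad (mat_diag k f) k y = (\<Sum>i<k. \<Sum>j<k. if j = i then f i * (y i)\<^sup>2 else 0)"
    unfolding quad_def by (intro sum.cong refl) (auto simp: mat_diag_def power2_eq_square)
  thus ?thesis by simp
qed

lemma quad_add:
  assumes "A \<in> carrier_mat k k" "B \<in> carrier_mat k k"
  shows "quad (A + B) k y = quad A k y + quad B k y"
  unfolding quad_def using assms by (simp add: sum.distrib[symmetric] algebra_simps)

lemma quad_smult: "A \<in> carrier_mat k k \<Longrightarrow> quad (c \<cdot>\<^sub>m A) k y = c * quad A k y"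
  unfolding quad_def by (simp add: sum_distrib_left mult_ac)

lemma pos_def_smult:
  assumes "pos_def k A" "0 < c"
  shows "pos_def k (c \<cdot>\<^sub>m A)"
  using assms by (auto simp: pos_def_def quad_smult)

lemma pos_def_one: "pos_def k (1\<^sub>m k)"
  unfolding pos_def_def
proof (intro conjI allI impI)
  fix y :: "nat \<Rightarrow> real" assume "\<exists>i<k. y i \<noteq> 0"
  then obtain i where "i < k" "y i \<noteq> 0" by blast
  hence "0 < (\<Sum>i<k. 1 * (y i)\<^sup>2)" by (intro sum_pos2[of _ i]) auto
  thus "0 < quad (1\<^sub>m k) k y"
    unfolding mat_diag_one[symmetric] quad_mat_diag .
qed auto

lemma quad_one: "quad (1\<^sub>m k) k y = (\<Sum>i<k. (y i)\<^sup>2)"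
  using quad_mat_diag[of k "\<lambda>_. 1" y] by simp

context
  fixes lam :: "nat \<Rightarrow> real" and \<phi> :: "nat \<Rightarrow> 'a \<Rightarrow> real" and n k :: nat and X :: "nat \<Rightarrow> 'a" and D :: "'a set"
  assumes X: "X \<in> good_designs D \<phi> n k" and n: "1 \<le> n"
    and lam: "\<And>j. 0 \<le> lam j" and inv: "invertible_mat (Lambda lam k)"
begin

lemma tgp_precision_carrier: "tgp_precision lam \<phi> n k X \<in> carrier_mat k k"
  by (simp add: tgp_precision_def mat_inv_Lambda[OF lam inv])

lemma tgp_precision_index:
  "i < k \<Longrightarrow> j < k \<Longrightarrow> tgp_precision lam \<phi> n k X $$ (i, j) =
     (\<Sum>l<n. \<phi> i (X l) * \<phi> j (X l)) + (if i = j then 1 / lam j else 0)"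
  using gram_carrier[of \<phi> n k X]
  by (simp add: tgp_precision_def mat_inv_Lambda[OF lam inv] gram_index mat_diag_def)

lemma quad_tgp_precision_ge:
  "real n / 2 * (\<Sum>i<k. (y i)\<^sup>2) \<le> quad (tgp_precision lam \<phi> n k X) k y"
proof -
  have "quad (tgp_precision lam \<phi> n k X) k y =
      (\<Sum>l<n. (\<Sum>j<k. \<phi> j (X l) * y j)\<^sup>2) + (\<Sum>i<k. 1 / lam i * (y i)\<^sup>2)"
    unfolding tgp_precision_def mat_inv_Lambda[OF lam inv]
    by (subst quad_add) (simp_all add: quad_gram quad_mat_diag)
  moreover have "0 \<le> (\<Sum>i<k. 1 / lam i * (y i)\<^sup>2)"
    using lam by (intro sum_nonneg) auto
  ultimately show ?thesis using good_design_sandwich(1)[OF X, of y] by linarith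
qed

lemma pos_def_tgp_precision: "pos_def k (tgp_precision lam \<phi> n k X)"
  unfolding pos_def_def
proof (intro conjI allI impI)
  fix y :: "nat \<Rightarrow> real" assume "\<exists>i<k. y i \<noteq> 0"
  then obtain i where "i < k" "y i \<noteq> 0" by blast
  hence "0 < (\<Sum>i<k. (y i)\<^sup>2)" by (intro sum_pos2[of _ i]) auto
  hence "0 < real n / 2 * (\<Sum>i<k. (y i)\<^sup>2)" using n by simp
  thus "0 < quad (tgp_precision lam \<phi> n k X) k y"
    using quad_tgp_precision_ge[of y] by linarith
qed (auto simp: tgp_precision_carrier tgp_precision_index mult_ac)

lemma
  shows mat_inv_tgp_precision_carrier: "mat_inv (tgp_precision lam \<phi> n k X) \<in> carrier_mat k k"
    and tgp_precision_mult_inv: "tgp_precision lam \<phi> n k X * mat_inv (tgp_precision lam \<phi> n k X) = 1\<^sub>m k"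
    and mat_inv_mult_tgp_precision: "mat_inv (tgp_precision lam \<phi> n k X) * tgp_precision lam \<phi> n k X = 1\<^sub>m k"
proof -
  have d: "det (tgp_precision lam \<phi> n k X) \<noteq> 0"
    using pos_def_det_pos[OF pos_def_tgp_precision] by simp
  show *: "mat_inv (tgp_precision lam \<phi> n k X) \<in> carrier_mat k k"
    "tgp_precision lam \<phi> n k X * mat_inv (tgp_precision lam \<phi> n k X) = 1\<^sub>m k"
    by (rule mat_mult_mat_inv[OF tgp_precision_carrier d])+
  show "mat_inv (tgp_precision lam \<phi> n k X) * tgp_precision lam \<phi> n k X = 1\<^sub>m k"
    by (rule mat_mult_left_right_inverse[OF tgp_precision_carrier *])
qed

lemma tgp_mean_carrier: "tgp_mean lam \<phi> n k Y X \<in> carrier_vec k"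
  unfolding tgp_mean_def
  by (intro mult_mat_vec_carrier[OF mat_inv_tgp_precision_carrier] mult_mat_vec_carrier[of _ k n])
    (simp_all add: design_def)

lemma tgp_precision_mult_mean:
  assumes "j < k"
  shows "(\<Sum>i<k. tgp_precision lam \<phi> n k X $$ (j, i) * tgp_mean lam \<phi> n k Y X $ i) = (\<Sum>l<n. \<phi> j (X l) * Y l)"
proof -
  let ?M = "tgp_precision lam \<phi> n k X" and ?T = "transpose_mat (design \<phi> n k X)"
  have T: "?T \<in> carrier_mat k n" by (simp add: design_def)
  have v: "?T *\<^sub>v vec n Y \<in> carrier_vec k" using T by (rule mult_mat_vec_carrier) simp
  have "?M *\<^sub>v tgp_mean lam \<phi> n k Y X = (?M * mat_inv ?M) *\<^sub>v (?T *\<^sub>v vec n Y)"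
    unfolding tgp_mean_def
    by (rule assoc_mult_mat_vec[symmetric, OF tgp_precision_carrier mat_inv_tgp_precision_carrier v])
  also have "\<dots> = ?T *\<^sub>v vec n Y" using v by (simp add: tgp_precision_mult_inv)
  finally have "(?M *\<^sub>v tgp_mean lam \<phi> n k Y X) $ j = (?T *\<^sub>v vec n Y) $ j" by simp
  moreover have "(?T *\<^sub>v vec n Y) $ j = (\<Sum>l<n. \<phi> j (X l) * Y l)"
    using assms by (subst mult_mat_vec_index[OF T]) (auto simp: design_def)
  ultimately show ?thesis
    using mult_mat_vec_index[OF tgp_precision_carrier tgp_mean_carrier assms] by simp
qed

text \<open>
  Here \<open>\<mu>\<close> is the vector of true means, so \<open>Y - \<mu>\<close> is the noise and \<open>\<mu> - \<Phi> \<theta>\<close> the error of the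
  truncated expansion. The normal equations \<open>M \<theta>' = \<Phi>\<^sup>T Y\<close> turn into \<open>M e = w\<close> for the error \<open>e\<close>
  of the posterior mean, with \<open>w\<close> the sum of a noise, a truncation and a shrinkage part; \<open>M \<ge> n / 2\<close> gives \<open>\<bar>e\<bar> \<le> (2 / n) \<bar>w\<bar>\<close>.
\<close>

lemma tgp_mean_error_le:
  assumes op: "op_norm (mat_inv (Lambda lam k)) < real n / 4"
  shows "(\<Sum>j<k. (tgp_mean lam \<phi> n k Y X $ j - \<theta> j)\<^sup>2) \<le> 12 / (real n)\<^sup>2 *
    ((\<Sum>j<k. (\<Sum>l<n. \<phi> j (X l) * (Y l - \<mu> l))\<^sup>2) +
     3 * real n / 2 * (\<Sum>l<n. (\<mu> l - (\<Sum>j<k. \<theta> j * \<phi> j (X l)))\<^sup>2) +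
     real n / 4 * (\<Sum>j<k. (\<theta> j)\<^sup>2 / lam j))"
proof -
  let ?M = "tgp_precision lam \<phi> n k X"
  define e where "e j = tgp_mean lam \<phi> n k Y X $ j - \<theta> j" for j
  define r where "r l = \<mu> l - (\<Sum>j<k. \<theta> j * \<phi> j (X l))" for l
  define A where "A j = (\<Sum>l<n. \<phi> j (X l) * (Y l - \<mu> l))" for j
  define B where "B j = (\<Sum>l<n. \<phi> j (X l) * r l)" for j
  define w where "w j = A j + B j + - (\<theta> j / lam j)" for j
  define E where "E = (\<Sum>j<k. (e j)\<^sup>2)"
  have n0: "0 < real n" using n by simp
  have Me: "(\<Sum>i<k. ?M $$ (j, i) * e i) = w j" if j: "j < k" for j
  proof -
    have "(\<Sum>i<k. ?M $$ (j, i) * \<theta> i) =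
        (\<Sum>i<k. (\<Sum>l<n. \<phi> j (X l) * (\<theta> i * \<phi> i (X l))) + (if i = j then \<theta> j / lam j else 0))"
      using j by (intro sum.cong refl)
        (auto simp: tgp_precision_index algebra_simps sum_distrib_left sum_distrib_right)
    also have "\<dots> = (\<Sum>l<n. \<phi> j (X l) * (\<Sum>i<k. \<theta> i * \<phi> i (X l))) + \<theta> j / lam j"
      using j by (simp add: sum.distrib sum_distrib_left) (rule sum.swap)
    finally have "(\<Sum>i<k. ?M $$ (j, i) * e i) =
        (\<Sum>l<n. \<phi> j (X l) * Y l) - (\<Sum>l<n. \<phi> j (X l) * (\<Sum>i<k. \<theta> i * \<phi> i (X l))) - \<theta> j / lam j"
      using tgp_precision_mult_mean[OF j, of Y] by (simp add: e_def right_diff_distrib sum_subtractf)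
    also have "\<dots> = w j"
      by (simp add: w_def A_def B_def r_def right_diff_distrib sum_subtractf)
    finally show ?thesis .
  qed
  have "real n / 2 * E \<le> quad ?M k e"
    unfolding E_def by (rule quad_tgp_precision_ge)
  also have "\<dots> = (\<Sum>j<k. e j * w j)"
    unfolding quad_def by (intro sum.cong refl) (simp add: Me[symmetric] sum_distrib_left mult_ac)
  also have "\<dots> \<le> (\<Sum>j<k. real n / 4 * (e j)\<^sup>2 + (w j)\<^sup>2 / real n)"
  proof (rule sum_mono)
    fix j
    \<comment> \<open>Half of the lower bound \<open>n / 2\<close> is spent on absorbing \<open>e\<close> on the right.\<close>
    have "0 \<le> (real n / 2 * e j - w j)\<^sup>2 / real n" by simp
    also have "\<dots> = real n / 4 * (e j)\<^sup>2 - e j * w j + (w j)\<^sup>2 / real n"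
      using n0 by (simp add: power2_eq_square field_simps)
    finally show "e j * w j \<le> real n / 4 * (e j)\<^sup>2 + (w j)\<^sup>2 / real n" by simp
  qed
  also have "\<dots> = real n / 4 * E + (\<Sum>j<k. (w j)\<^sup>2) / real n"
    by (simp add: E_def sum.distrib sum_distrib_left sum_divide_distrib)
  finally have "E \<le> 4 / (real n)\<^sup>2 * (\<Sum>j<k. (w j)\<^sup>2)"
    using n0 by (simp add: power2_eq_square field_simps)
  also have "\<dots> \<le> 4 / (real n)\<^sup>2 * (3 * ((\<Sum>j<k. (A j)\<^sup>2) + 3 * real n / 2 * (\<Sum>l<n. (r l)\<^sup>2) + real n / 4 * (\<Sum>j<k. (\<theta> j)\<^sup>2 / lam j)))"
  proof (rule mult_left_mono)
    have "(\<Sum>j<k. (w j)\<^sup>2) \<le> (\<Sum>j<k. 3 * ((A j)\<^sup>2 + (B j)\<^sup>2 + (\<theta> j / lam j)\<^sup>2))"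
      unfolding w_def using three_term_square_le[of _ _ "- _"] by (intro sum_mono) (metis power2_minus)
    also have "\<dots> = 3 * ((\<Sum>j<k. (A j)\<^sup>2) + (\<Sum>j<k. (B j)\<^sup>2) + (\<Sum>j<k. (\<theta> j / lam j)\<^sup>2))"
      by (simp add: sum_distrib_left sum.distrib)
    also have "(\<Sum>j<k. (B j)\<^sup>2) \<le> 3 * real n / 2 * (\<Sum>l<n. (r l)\<^sup>2)"
      unfolding B_def by (rule adjoint_square_le[where a = "\<lambda>l j. \<phi> j (X l)"]) (use good_design_sandwich(2)[OF X] in auto)
    also have "(\<Sum>j<k. (\<theta> j / lam j)\<^sup>2) \<le> real n / 4 * (\<Sum>j<k. (\<theta> j)\<^sup>2 / lam j)"
      unfolding sum_distrib_left
    proof (rule sum_mono)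
      fix j assume "j \<in> {..<k}"
      hence j: "j < k" by simp
      \<comment> \<open>Test the operator norm on the \<open>j\<close>-th unit vector.\<close>
      have "1 / lam j \<le> op_norm (mat_inv (Lambda lam k))"
        using abs_quad_le_op_norm[of "mat_inv (Lambda lam k)" k "\<lambda>i. if i = j then 1 else 0"] j lam
        by (simp add: mat_inv_Lambda[OF lam inv] quad_mat_diag if_distrib[of "\<lambda>x. x\<^sup>2"] if_distrib[of "\<lambda>x. _ * x"] cong: if_cong)
      hence "(\<theta> j)\<^sup>2 / lam j * (1 / lam j) \<le> (\<theta> j)\<^sup>2 / lam j * (real n / 4)"
        using op lam by (intro mult_left_mono) auto
      thus "(\<theta> j / lam j)\<^sup>2 \<le> real n / 4 * ((\<theta> j)\<^sup>2 / lam j)"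
        by (simp add: power2_eq_square mult_ac)
    qed
    finally show "(\<Sum>j<k. (w j)\<^sup>2) \<le> 3 * ((\<Sum>j<k. (A j)\<^sup>2) + 3 * real n / 2 * (\<Sum>l<n. (r l)\<^sup>2) + real n / 4 * (\<Sum>j<k. (\<theta> j)\<^sup>2 / lam j))"
      by simp
  qed simp
  finally show ?thesis by (simp add: E_def e_def A_def r_def)
qed

end

section \<open>Expectations under the truth\<close>

lemma nn_integral_normal_affine_square:
  assumes "0 < \<sigma>"
  shows "(\<integral>\<^sup>+t. ennreal ((c + a * (t - \<mu>))\<^sup>2) \<partial>density lborel (normal_density \<mu> \<sigma>)) = ennreal (c\<^sup>2 + a\<^sup>2 * \<sigma>\<^sup>2)"
proof -
  have 0: "has_bochner_integral lborel (\<lambda>t. normal_density \<mu> \<sigma> t * (t - \<mu>) ^ (2 * 0)) 1"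
    using normal_moment_even[OF assms, of \<mu> 0] by simp
  have 1: "has_bochner_integral lborel (\<lambda>t. normal_density \<mu> \<sigma> t * (t - \<mu>) ^ (2 * 0 + 1)) 0"
    using normal_moment_odd[OF assms, of \<mu> 0] .
  have 2: "has_bochner_integral lborel (\<lambda>t. normal_density \<mu> \<sigma> t * (t - \<mu>) ^ (2 * 1)) (\<sigma>\<^sup>2)"
    using normal_moment_even[OF assms, of \<mu> 1] by simp
  have "has_bochner_integral lborel
      (\<lambda>t. (c\<^sup>2 * (normal_density \<mu> \<sigma> t * (t - \<mu>) ^ (2 * 0)) +
            (2 * c * a) * (normal_density \<mu> \<sigma> t * (t - \<mu>) ^ (2 * 0 + 1))) +
            a\<^sup>2 * (normal_density \<mu> \<sigma> t * (t - \<mu>) ^ (2 * 1)))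
      ((c\<^sup>2 * 1 + (2 * c * a) * 0) + a\<^sup>2 * \<sigma>\<^sup>2)"
    by (intro has_bochner_integral_add has_bochner_integral_mult_right 0 1 2)
  also have "(\<lambda>t. (c\<^sup>2 * (normal_density \<mu> \<sigma> t * (t - \<mu>) ^ (2 * 0)) +
            (2 * c * a) * (normal_density \<mu> \<sigma> t * (t - \<mu>) ^ (2 * 0 + 1))) +
            a\<^sup>2 * (normal_density \<mu> \<sigma> t * (t - \<mu>) ^ (2 * 1))) =
      (\<lambda>t. normal_density \<mu> \<sigma> t * (c + a * (t - \<mu>))\<^sup>2)"
    by (rule ext) (simp add: power2_eq_square algebra_simps)
  finally have I: "has_bochner_integral lborel (\<lambda>t. normal_density \<mu> \<sigma> t * (c + a * (t - \<mu>))\<^sup>2) (c\<^sup>2 + a\<^sup>2 * \<sigma>\<^sup>2)"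
    by simp
  have "(\<integral>\<^sup>+t. ennreal ((c + a * (t - \<mu>))\<^sup>2) \<partial>density lborel (normal_density \<mu> \<sigma>)) =
      (\<integral>\<^sup>+t. ennreal (normal_density \<mu> \<sigma> t * (c + a * (t - \<mu>))\<^sup>2) \<partial>lborel)"
    by (subst nn_integral_density) (auto simp: ennreal_mult')
  also have "\<dots> = ennreal (c\<^sup>2 + a\<^sup>2 * \<sigma>\<^sup>2)"
    by (subst nn_integral_eq_integral) (use I in \<open>auto simp: has_bochner_integral_iff\<close>)
  finally show ?thesis .
qed

text \<open>
  Centred independent noise adds variances. The constant \<open>c\<close> is there for the induction: integrating
  the last coordinate leaves a square of the same kind in the others.
\<close>

lemma nn_integral_normal_noise_square:
  fixes a \<mu> :: "nat \<Rightarrow> real"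
  assumes \<sigma>: "0 < \<sigma>"
  shows "(\<integral>\<^sup>+Y. ennreal ((c + (\<Sum>l<n. a l * (Y l - \<mu> l)))\<^sup>2)
      \<partial>(\<Pi>\<^sub>M l\<in>{..<n}. density lborel (normal_density (\<mu> l) \<sigma>))) = ennreal (c\<^sup>2 + \<sigma>\<^sup>2 * (\<Sum>l<n. (a l)\<^sup>2))"
proof (induction n arbitrary: c)
  case 0
  have "emeasure (PiM {} (\<lambda>l. density lborel (normal_density (\<mu> l) \<sigma>))) (space (PiM {} (\<lambda>l. density lborel (normal_density (\<mu> l) \<sigma>)))) = 1"
    by (simp add: PiM_empty)
  thus ?case by simp
next
  case (Suc n)
  let ?N = "\<lambda>l. density lborel (normal_density (\<mu> l) \<sigma>)"
  have prob: "prob_space (?N l)" for l by (rule prob_space_normal_density[OF \<sigma>])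
  interpret product_prob_space ?N
    by (intro product_prob_spaceI prob)
  interpret PN: prob_space "PiM {..<n} ?N" by (rule prob_space_PiM) (rule prob)
  have ins: "{..<Suc n} = insert n {..<n}" by auto
  have sets: "sets (PiM J ?N) = sets (\<Pi>\<^sub>M l\<in>J. borel)" for J
    by (rule sets_PiM_cong) auto
  have meas: "(\<lambda>Y. ennreal ((c + (\<Sum>l<m. a l * (Y l - \<mu> l)))\<^sup>2)) \<in> borel_measurable (PiM {..<m} ?N)" for m
    unfolding measurable_cong_sets[OF sets refl] by measurable
  have "(\<integral>\<^sup>+Y. ennreal ((c + (\<Sum>l<Suc n. a l * (Y l - \<mu> l)))\<^sup>2) \<partial>PiM {..<Suc n} ?N) =
      (\<integral>\<^sup>+Y. \<integral>\<^sup>+t. ennreal ((c + (\<Sum>l<Suc n. a l * ((Y(n := t)) l - \<mu> l)))\<^sup>2) \<partial>?N n \<partial>PiM {..<n} ?N)"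
    unfolding ins by (rule product_nn_integral_insert) (use meas[of "Suc n"] in \<open>simp_all add: ins\<close>)
  also have "\<dots> = (\<integral>\<^sup>+Y. ennreal ((c + (\<Sum>l<n. a l * (Y l - \<mu> l)))\<^sup>2) + ennreal ((a n)\<^sup>2 * \<sigma>\<^sup>2) \<partial>PiM {..<n} ?N)"
  proof (rule nn_integral_cong)
    fix Y :: "nat \<Rightarrow> real"
    have "c + (\<Sum>l<Suc n. a l * ((Y(n := t)) l - \<mu> l)) = (c + (\<Sum>l<n. a l * (Y l - \<mu> l))) + a n * (t - \<mu> n)" for t
      by simp
    thus "(\<integral>\<^sup>+t. ennreal ((c + (\<Sum>l<Suc n. a l * ((Y(n := t)) l - \<mu> l)))\<^sup>2) \<partial>?N n) =
        ennreal ((c + (\<Sum>l<n. a l * (Y l - \<mu> l)))\<^sup>2) + ennreal ((a n)\<^sup>2 * \<sigma>\<^sup>2)"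
      by (simp only: nn_integral_normal_affine_square[OF \<sigma>]) (simp add: ennreal_plus)
  qed
  also have "\<dots> = ennreal (c\<^sup>2 + \<sigma>\<^sup>2 * (\<Sum>l<n. (a l)\<^sup>2)) + ennreal ((a n)\<^sup>2 * \<sigma>\<^sup>2)"
    by (subst nn_integral_add) (simp_all add: meas Suc.IH PN.emeasure_space_1)
  also have "\<dots> = ennreal (c\<^sup>2 + \<sigma>\<^sup>2 * (\<Sum>l<Suc n. (a l)\<^sup>2))"
    by (subst ennreal_plus[symmetric]) (auto simp: algebra_simps sum_nonneg)
  finally show ?case .
qed

text \<open>
  The bind in \<open>truth\<close> is meaningful only for a measurable kernel. On boxes the kernel is a finite
  product of normal probabilities, each measurable in its design point, and boxes generate.
\<close>

lemma measurable_normal_product_kernel: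
  assumes f[measurable]: "f \<in> borel_measurable P" and \<sigma>: "0 < \<sigma>"
  shows "(\<lambda>X. \<Pi>\<^sub>M l\<in>{..<n}. density lborel (normal_density (f (X l)) \<sigma>)) \<in>
    (\<Pi>\<^sub>M l\<in>{..<n::nat}. P) \<rightarrow>\<^sub>M prob_algebra (\<Pi>\<^sub>M l\<in>{..<n}. borel)"
proof (rule measurable_prob_algebra_generated[OF sets_PiM Int_stable_prod_algebra prod_algebra_sets_into_space])
  let ?N = "\<lambda>\<mu>. density lborel (normal_density \<mu> \<sigma>)"
  have prob: "prob_space (?N \<mu>)" for \<mu> by (rule prob_space_normal_density[OF \<sigma>])
  show "prob_space (\<Pi>\<^sub>M l\<in>{..<n}. ?N (f (X l)))" for X
    by (rule prob_space_PiM) (rule prob)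
  show "sets (\<Pi>\<^sub>M l\<in>{..<n}. ?N (f (X l))) = sets (\<Pi>\<^sub>M l\<in>{..<n}. borel)" for X
    by (rule sets_PiM_cong) auto
  fix A assume "A \<in> prod_algebra {..<n} (\<lambda>_. borel :: real measure)"
  then obtain E where A: "A = Pi\<^sub>E {..<n} E" and E: "E \<in> (\<Pi> l\<in>{..<n}. sets borel)"
    by (rule prod_algebraE_all)
  have "emeasure (\<Pi>\<^sub>M l\<in>{..<n}. ?N (f (X l))) A = (\<Prod>l<n. \<integral>\<^sup>+t. ennreal (normal_density (f (X l)) \<sigma> t) * indicator (E l) t \<partial>lborel)" for X
  proof -
    interpret product_prob_space "\<lambda>l. ?N (f (X l))"
      by (intro product_prob_spaceI prob)
    have "emeasure (\<Pi>\<^sub>M l\<in>{..<n}. ?N (f (X l))) A = (\<Prod>l<n. emeasure (?N (f (X l))) (E l))"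
      unfolding A by (rule emeasure_PiM) (use E in auto)
    also have "\<dots> = (\<Prod>l<n. \<integral>\<^sup>+t. ennreal (normal_density (f (X l)) \<sigma> t) * indicator (E l) t \<partial>lborel)"
      using E by (intro prod.cong refl emeasure_density) auto
    finally show ?thesis .
  qed
  moreover have "(\<lambda>X. \<Prod>l<n. \<integral>\<^sup>+t. ennreal (normal_density (f (X l)) \<sigma> t) * indicator (E l) t \<partial>lborel) \<in> borel_measurable (\<Pi>\<^sub>M l\<in>{..<n}. P)"
  proof (rule borel_measurable_prod_ennreal)
    fix l assume l: "l \<in> {..<n}"
    have [measurable]: "E l \<in> sets borel" using E l by auto
    have [measurable]: "(\<lambda>X. X l) \<in> (\<Pi>\<^sub>M l\<in>{..<n}. P) \<rightarrow>\<^sub>M P" using l by measurable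
    show "(\<lambda>X. \<integral>\<^sup>+t. ennreal (normal_density (f (X l)) \<sigma> t) * indicator (E l) t \<partial>lborel) \<in> borel_measurable (\<Pi>\<^sub>M l\<in>{..<n}. P)"
      unfolding normal_density_def by measurable
  qed
  ultimately show "(\<lambda>X. emeasure (\<Pi>\<^sub>M l\<in>{..<n}. ?N (f (X l))) A) \<in> borel_measurable (\<Pi>\<^sub>M l\<in>{..<n}. P)"
    by simp
qed

lemma nn_integral_truth:
  assumes f: "f \<in> borel_measurable P" and \<sigma>: "0 < \<sigma>"
    and g: "g \<in> borel_measurable ((\<Pi>\<^sub>M l\<in>{..<n}. borel) \<Otimes>\<^sub>M (\<Pi>\<^sub>M l\<in>{..<n}. P))"
  shows "(\<integral>\<^sup>+w. g w \<partial>truth P f \<sigma> n) =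
    (\<integral>\<^sup>+X. \<integral>\<^sup>+Y. g (Y, X) \<partial>(\<Pi>\<^sub>M l\<in>{..<n}. density lborel (normal_density (f (X l)) \<sigma>)) \<partial>(\<Pi>\<^sub>M l\<in>{..<n}. P))"
proof -
  let ?B = "(\<Pi>\<^sub>M l\<in>{..<n}. borel) \<Otimes>\<^sub>M (\<Pi>\<^sub>M l\<in>{..<n}. P)"
  let ?K = "\<lambda>X. \<Pi>\<^sub>M l\<in>{..<n}. density lborel (normal_density (f (X l)) \<sigma>)"
  have K: "?K \<in> (\<Pi>\<^sub>M l\<in>{..<n}. P) \<rightarrow>\<^sub>M subprob_algebra (\<Pi>\<^sub>M l\<in>{..<n}. borel)"
    by (rule measurable_prob_algebraD[OF measurable_normal_product_kernel[OF f \<sigma>]])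
  have "(\<lambda>X. distr (?K X) ?B (\<lambda>Y. (Y, X))) \<in> (\<Pi>\<^sub>M l\<in>{..<n}. P) \<rightarrow>\<^sub>M subprob_algebra ?B"
    by (rule measurable_distr2[OF _ K]) measurable
  hence "(\<integral>\<^sup>+w. g w \<partial>truth P f \<sigma> n) =
      (\<integral>\<^sup>+X. \<integral>\<^sup>+w. g w \<partial>distr (?K X) ?B (\<lambda>Y. (Y, X)) \<partial>(\<Pi>\<^sub>M l\<in>{..<n}. P))"
    unfolding truth_def by (rule nn_integral_bind[OF g])
  also have "\<dots> = (\<integral>\<^sup>+X. \<integral>\<^sup>+Y. g (Y, X) \<partial>?K X \<partial>(\<Pi>\<^sub>M l\<in>{..<n}. P))"
  proof (rule nn_integral_cong)
    fix X assume X: "X \<in> space (\<Pi>\<^sub>M l\<in>{..<n}. P)"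
    have "sets (?K X) = sets (\<Pi>\<^sub>M l\<in>{..<n}. borel)"
      by (rule sets_PiM_cong) auto
    hence "(\<lambda>Y. (Y, X)) \<in> ?K X \<rightarrow>\<^sub>M ?B"
      using measurable_Pair2'[OF X] by (simp cong: measurable_cong_sets)
    thus "(\<integral>\<^sup>+w. g w \<partial>distr (?K X) ?B (\<lambda>Y. (Y, X))) = (\<integral>\<^sup>+Y. g (Y, X) \<partial>?K X)"
      by (rule nn_integral_distr) (use g in simp)
  qed
  finally show ?thesis .
qed

lemma nn_integral_iid_sum:
  fixes n :: nat
  assumes P: "prob_space P" and h: "h \<in> borel_measurable P"
  shows "(\<integral>\<^sup>+X. (\<Sum>l<n. h (X l)) \<partial>(\<Pi>\<^sub>M l\<in>{..<n}. P)) = of_nat n * (\<integral>\<^sup>+x. h x \<partial>P)"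
proof -
  have comp: "(\<lambda>X. X l) \<in> (\<Pi>\<^sub>M l\<in>{..<n}. P) \<rightarrow>\<^sub>M P" if "l < n" for l
    by (rule measurable_component_singleton) (use that in simp)
  have "(\<integral>\<^sup>+X. (\<Sum>l<n. h (X l)) \<partial>(\<Pi>\<^sub>M l\<in>{..<n}. P)) = (\<Sum>l<n. \<integral>\<^sup>+X. h (X l) \<partial>(\<Pi>\<^sub>M l\<in>{..<n}. P))"
    by (rule nn_integral_sum) (use measurable_compose[OF comp h] in auto)
  also have "\<dots> = (\<Sum>l<n. \<integral>\<^sup>+x. h x \<partial>P)"
  proof (rule sum.cong[OF refl])
    fix l assume "l \<in> {..<n}"
    hence l: "l < n" by simp
    have "(\<integral>\<^sup>+X. h (X l) \<partial>(\<Pi>\<^sub>M l\<in>{..<n}. P)) = (\<integral>\<^sup>+x. h x \<partial>distr (\<Pi>\<^sub>M l\<in>{..<n}. P) P (\<lambda>X. X l))"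
      by (rule nn_integral_distr[symmetric, OF comp[OF l]]) (use h in simp)
    also have "distr (\<Pi>\<^sub>M l\<in>{..<n}. P) P (\<lambda>X. X l) = P"
      by (rule distr_PiM_component) (use P l in auto)
    finally show "(\<integral>\<^sup>+X. h (X l) \<partial>(\<Pi>\<^sub>M l\<in>{..<n}. P)) = (\<integral>\<^sup>+x. h x \<partial>P)" .
  qed
  finally show ?thesis by simp
qed

lemma square_integrable_add_smult:
  assumes "square_integrable P f" "square_integrable P g"
  shows "square_integrable P (\<lambda>x. f x + c * g x)"
proof -
  have [measurable]: "f \<in> borel_measurable P" "g \<in> borel_measurable P"
    and I: "integrable P (\<lambda>x. (f x)\<^sup>2)" "integrable P (\<lambda>x. (g x)\<^sup>2)"
    using assms by (auto simp: square_integrable_def)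
  have "integrable P (\<lambda>x. (f x + c * g x)\<^sup>2)"
  proof (rule Bochner_Integration.integrable_bound)
    show "integrable P (\<lambda>x. 3 * ((f x)\<^sup>2 + c\<^sup>2 * (g x)\<^sup>2))"
      using I by (intro integrable_mult_right integrable_add) auto
    have "(f x + c * g x)\<^sup>2 \<le> 3 * ((f x)\<^sup>2 + c\<^sup>2 * (g x)\<^sup>2)" for x
      using three_term_square_le[of "f x" "c * g x" 0] by (simp add: power_mult_distrib)
    thus "AE x in P. norm ((f x + c * g x)\<^sup>2) \<le> norm (3 * ((f x)\<^sup>2 + c\<^sup>2 * (g x)\<^sup>2))"
      by simp
  qed measurable
  thus ?thesis by (simp add: square_integrable_def)
qed

lemma square_integrable_truncation_error:
  assumes "square_integrable P f" "\<And>j. square_integrable P (\<phi> j)"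
  shows "square_integrable P (\<lambda>x. f x - truncation P \<phi> f k x)"
proof (induction k)
  case 0
  thus ?case using assms by (simp add: truncation_def)
next
  case (Suc k)
  from square_integrable_add_smult[OF this assms(2)[of k], of "- coeff_L2 P \<phi> f k"]
  show ?case by (simp add: truncation_def algebra_simps)
qed

lemma nn_integral_square:
  "square_integrable P g \<Longrightarrow> (\<integral>\<^sup>+x. ennreal ((g x)\<^sup>2) \<partial>P) = ennreal ((L2_norm P g)\<^sup>2)"
  by (simp add: square_integrable_def L2_norm_def nn_integral_eq_integral)

lemma prob_space_covariate_law: "is_density d D \<rho> \<Longrightarrow> prob_space (covariate_law d D \<rho>)"
proof (rule prob_spaceI)
  assume \<rho>: "is_density d D \<rho>"
  let ?M = "restrict_space (euclid d) D"
  have "emeasure (covariate_law d D \<rho>) (space ?M) = (\<integral>\<^sup>+x. ennreal (\<rho> x) * indicator (space ?M) x \<partial>?M)"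
    unfolding covariate_law_def
    by (rule emeasure_density[OF _ sets.top]) (use \<rho> in \<open>auto simp: is_density_def\<close>)
  also have "\<dots> = (\<integral>\<^sup>+x. ennreal (\<rho> x) \<partial>?M)" by (rule nn_integral_cong) simp
  also have "\<dots> = 1" using \<rho> by (simp add: is_density_def)
  finally show "emeasure (covariate_law d D \<rho>) (space (covariate_law d D \<rho>)) = 1"
    by (simp add: covariate_law_def)
qed

text \<open>
  Given the design, the noise term has mean \<open>\<sigma>\<^sup>2\<close> times the trace of the Gram matrix; orthonormality
  turns the expected trace into \<open>n k\<close>.
\<close>

lemma expected_error_terms:
  assumes P: "prob_space P" and \<phi>: "orthonormal_L2 P \<phi>" and f: "square_integrable P f" and \<sigma>: "0 < \<sigma>"
    and r: "square_integrable P r"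
  shows "(\<integral>\<^sup>+(Y, X). a + b * (\<Sum>j<k. ennreal ((\<Sum>l<n. \<phi> j (X l) * (Y l - f (X l)))\<^sup>2)) +
        c * (\<Sum>l<n. ennreal ((r (X l))\<^sup>2)) \<partial>truth P f \<sigma> n)
    = a + b * ennreal (\<sigma>\<^sup>2 * real n * real k) + c * ennreal (real n * (L2_norm P r)\<^sup>2)"
proof -
  interpret P: prob_space P by fact
  interpret PX: prob_space "\<Pi>\<^sub>M l\<in>{..<n}. P" by (rule prob_space_PiM) (rule P)
  let ?K = "\<lambda>X. \<Pi>\<^sub>M l\<in>{..<n}. density lborel (normal_density (f (X l)) \<sigma>)"
  have sq: "square_integrable P (\<phi> j)" for j using \<phi> by (simp add: orthonormal_L2_def)
  have one: "L2_norm P (\<phi> j) = 1" for j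
    using \<phi> by (simp add: orthonormal_L2_def L2_norm_def power2_eq_square)
  have [measurable]: "\<phi> j \<in> borel_measurable P" "f \<in> borel_measurable P" "r \<in> borel_measurable P" for j
    using sq f r by (auto simp: square_integrable_def)
  have sets: "sets (?K X) = sets (\<Pi>\<^sub>M l\<in>{..<n}. borel)" for X
    by (rule sets_PiM_cong) auto
  have "(\<integral>\<^sup>+(Y, X). a + b * (\<Sum>j<k. ennreal ((\<Sum>l<n. \<phi> j (X l) * (Y l - f (X l)))\<^sup>2)) +
        c * (\<Sum>l<n. ennreal ((r (X l))\<^sup>2)) \<partial>truth P f \<sigma> n) =
     (\<integral>\<^sup>+X. \<integral>\<^sup>+Y. a + b * (\<Sum>j<k. ennreal ((\<Sum>l<n. \<phi> j (X l) * (Y l - f (X l)))\<^sup>2)) +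
        c * (\<Sum>l<n. ennreal ((r (X l))\<^sup>2)) \<partial>?K X \<partial>(\<Pi>\<^sub>M l\<in>{..<n}. P))"
    by (subst nn_integral_truth[OF _ \<sigma>]) (simp_all, measurable)
  also have "\<dots> = (\<integral>\<^sup>+X. a + b * (\<Sum>j<k. ennreal (\<sigma>\<^sup>2) * (\<Sum>l<n. ennreal ((\<phi> j (X l))\<^sup>2))) +
        c * (\<Sum>l<n. ennreal ((r (X l))\<^sup>2)) \<partial>(\<Pi>\<^sub>M l\<in>{..<n}. P))"
  proof (rule nn_integral_cong)
    fix X :: "nat \<Rightarrow> 'a"
    interpret K: prob_space "?K X" by (rule prob_space_PiM) (rule prob_space_normal_density[OF \<sigma>])
    have [measurable]: "(\<lambda>Y. ennreal ((\<Sum>l<n. \<phi> j (X l) * (Y l - f (X l)))\<^sup>2)) \<in> borel_measurable (?K X)" for j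
      unfolding measurable_cong_sets[OF sets refl] by measurable
    have "(\<integral>\<^sup>+Y. ennreal ((\<Sum>l<n. \<phi> j (X l) * (Y l - f (X l)))\<^sup>2) \<partial>?K X) = ennreal (\<sigma>\<^sup>2) * (\<Sum>l<n. ennreal ((\<phi> j (X l))\<^sup>2))" for j
      using nn_integral_normal_noise_square[OF \<sigma>, where c = 0 and a = "\<lambda>l. \<phi> j (X l)" and \<mu> = "\<lambda>l. f (X l)" and n = n]
      by (simp add: ennreal_mult sum_nonneg sum_ennreal)
    thus "(\<integral>\<^sup>+Y. a + b * (\<Sum>j<k. ennreal ((\<Sum>l<n. \<phi> j (X l) * (Y l - f (X l)))\<^sup>2)) +
        c * (\<Sum>l<n. ennreal ((r (X l))\<^sup>2)) \<partial>?K X) =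
       a + b * (\<Sum>j<k. ennreal (\<sigma>\<^sup>2) * (\<Sum>l<n. ennreal ((\<phi> j (X l))\<^sup>2))) +
        c * (\<Sum>l<n. ennreal ((r (X l))\<^sup>2))"
      by (simp add: nn_integral_add nn_integral_cmult nn_integral_sum K.emeasure_space_1 del: sum_ennreal)
  qed
  also have "\<dots> = a + b * (\<Sum>j<k. ennreal (\<sigma>\<^sup>2) * (of_nat n * (\<integral>\<^sup>+x. ennreal ((\<phi> j x)\<^sup>2) \<partial>P))) +
      c * (of_nat n * (\<integral>\<^sup>+x. ennreal ((r x)\<^sup>2) \<partial>P))"
    by (simp add: nn_integral_add nn_integral_cmult nn_integral_sum PX.emeasure_space_1
        nn_integral_iid_sum[OF P, symmetric] del: sum_ennreal)
  also have "\<dots> = a + b * ennreal (\<sigma>\<^sup>2 * real n * real k) + c * ennreal (real n * (L2_norm P r)\<^sup>2)"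
    by (simp add: nn_integral_square[OF sq] nn_integral_square[OF r] one ennreal_mult ennreal_of_nat_eq_real_of_nat mult_ac)
  finally show ?thesis .
qed

section \<open>The Wasserstein bound\<close>

lemma smult_mult_smult:
  fixes A B :: "real mat"
  assumes "A \<in> carrier_mat k k" "B \<in> carrier_mat k k" "A * B = 1\<^sub>m k" "a * b = 1"
  shows "(a \<cdot>\<^sub>m A) * (b \<cdot>\<^sub>m B) = 1\<^sub>m k"
proof -
  have "(a \<cdot>\<^sub>m A) * (b \<cdot>\<^sub>m B) = a \<cdot>\<^sub>m (A * (b \<cdot>\<^sub>m B))"
    by (rule mult_smult_assoc_mat) (use assms in auto)
  also have "A * (b \<cdot>\<^sub>m B) = b \<cdot>\<^sub>m (A * B)"
    by (rule mult_smult_distrib) (use assms in auto)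
  also have "a \<cdot>\<^sub>m (b \<cdot>\<^sub>m (A * B)) = 1\<^sub>m k"
    unfolding assms(3) by (rule eq_matI) (use assms(4) in auto)
  finally show ?thesis .
qed

text \<open>
  The precisions are at least \<open>n / (2 \<sigma>\<^sup>2)\<close> for the posterior and equal to \<open>n / \<sigma>\<^sup>2\<close> for the target, so the two
  second moments contribute \<open>3 (2 + 1) \<sigma>\<^sup>2 k / n\<close>.
\<close>

lemma wasserstein2_tgp_posterior_le:
  fixes lam :: "nat \<Rightarrow> real" and \<phi> :: "nat \<Rightarrow> 'a \<Rightarrow> real"
  assumes X: "X \<in> good_designs D \<phi> n k" and n: "1 \<le> n" and \<sigma>: "0 < \<sigma>"
    and lam: "\<And>j. 0 \<le> lam j" and inv: "invertible_mat (Lambda lam k)" and \<theta>: "\<theta> \<in> carrier_vec k"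
  shows "(wasserstein2 k (tgp_posterior lam \<phi> \<sigma> n k Y X) (gaussian \<theta> ((\<sigma>\<^sup>2 / real n) \<cdot>\<^sub>m 1\<^sub>m k)))\<^sup>2 \<le>
    ennreal (9 * \<sigma>\<^sup>2 * real k / real n + 3 * (\<Sum>j<k. (tgp_mean lam \<phi> n k Y X $ j - \<theta> $ j)\<^sup>2))"
proof -
  let ?M = "tgp_precision lam \<phi> n k X" and ?t = "tgp_mean lam \<phi> n k Y X"
  note ctx = X n lam inv
  have t: "?t \<in> carrier_vec k" by (rule tgp_mean_carrier[OF ctx])
  have M: "?M \<in> carrier_mat k k" by (rule tgp_precision_carrier[OF ctx])
  have iM: "mat_inv ?M \<in> carrier_mat k k" by (rule mat_inv_tgp_precision_carrier[OF ctx])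
  have n0: "0 < real n" using n by simp
  have S1: "tgp_cov lam \<phi> \<sigma> n k X \<in> carrier_mat k k" using iM by (simp add: tgp_cov_def)
  have A1: "pos_def k ((1 / \<sigma>\<^sup>2) \<cdot>\<^sub>m ?M)"
    by (rule pos_def_smult[OF pos_def_tgp_precision[OF ctx]]) (use \<sigma> in simp)
  have SA1: "tgp_cov lam \<phi> \<sigma> n k X * ((1 / \<sigma>\<^sup>2) \<cdot>\<^sub>m ?M) = 1\<^sub>m k"
    unfolding tgp_cov_def
    by (rule smult_mult_smult[OF iM M mat_inv_mult_tgp_precision[OF ctx]]) (use \<sigma> in simp)
  have c1: "real n / (2 * \<sigma>\<^sup>2) * (\<Sum>i<k. (y i)\<^sup>2) \<le> quad ((1 / \<sigma>\<^sup>2) \<cdot>\<^sub>m ?M) k y" for y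
    using quad_tgp_precision_ge[OF ctx, of y] \<sigma> by (simp add: quad_smult[OF M] field_simps)
  have c1': "0 < real n / (2 * \<sigma>\<^sup>2)" using n0 \<sigma> by simp
  have S2: "(\<sigma>\<^sup>2 / real n) \<cdot>\<^sub>m 1\<^sub>m k \<in> carrier_mat k k" by simp
  have A2: "pos_def k ((real n / \<sigma>\<^sup>2) \<cdot>\<^sub>m 1\<^sub>m k)"
    by (rule pos_def_smult[OF pos_def_one]) (use n0 \<sigma> in simp)
  have SA2: "((\<sigma>\<^sup>2 / real n) \<cdot>\<^sub>m 1\<^sub>m k) * ((real n / \<sigma>\<^sup>2) \<cdot>\<^sub>m 1\<^sub>m k) = 1\<^sub>m k"
    by (rule smult_mult_smult) (use n0 \<sigma> in auto)
  have c2: "real n / \<sigma>\<^sup>2 * (\<Sum>i<k. (y i)\<^sup>2) \<le> quad ((real n / \<sigma>\<^sup>2) \<cdot>\<^sub>m 1\<^sub>m k) k y" for y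
    by (simp add: quad_smult quad_one)
  have c2': "0 < real n / \<sigma>\<^sup>2" using n0 \<sigma> by simp
  note G1 = prob_space_gaussian[OF t S1 A1 SA1 c1' c1] gaussian_second_moment_le[OF t S1 A1 SA1 c1' c1]
  note G2 = prob_space_gaussian[OF \<theta> S2 A2 SA2 c2' c2] gaussian_second_moment_le[OF \<theta> S2 A2 SA2 c2' c2]
  have "(wasserstein2 k (tgp_posterior lam \<phi> \<sigma> n k Y X) (gaussian \<theta> ((\<sigma>\<^sup>2 / real n) \<cdot>\<^sub>m 1\<^sub>m k)))\<^sup>2 \<le>
    ennreal (3 * (real k / (real n / (2 * \<sigma>\<^sup>2)) + (\<Sum>j<k. (?t $ j - \<theta> $ j)\<^sup>2) + real k / (real n / \<sigma>\<^sup>2)))"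
    unfolding tgp_posterior_def
    by (rule wasserstein2_square_le[OF G1(1) _ G2(1) _ G1(2) _ G2(2)]) (use t \<theta> in auto)
  also have "3 * (real k / (real n / (2 * \<sigma>\<^sup>2)) + (\<Sum>j<k. (?t $ j - \<theta> $ j)\<^sup>2) + real k / (real n / \<sigma>\<^sup>2)) =
      9 * \<sigma>\<^sup>2 * real k / real n + 3 * (\<Sum>j<k. (?t $ j - \<theta> $ j)\<^sup>2)"
    using n0 \<sigma> by (simp add: field_simps)
  finally show ?thesis .
qed

lemma H_norm_square: "(\<And>j. 0 \<le> lam j) \<Longrightarrow> (H_norm lam \<theta>)\<^sup>2 = (\<Sum>j<dim_vec \<theta>. (\<theta> $ j)\<^sup>2 / lam j)"
  by (simp add: H_norm_def sum_nonneg)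

text \<open>
  The bound for covariates with an arbitrary law \<open>P\<close> on an arbitrary space, with its constant. Taking
  expectations in \<open>wasserstein2_tgp_posterior_le\<close> and \<open>tgp_mean_error_le\<close> gives \<open>9 + 36 = 45\<close> for the term
  \<open>\<sigma>\<^sup>2 k / n\<close>, \<open>9\<close> for the norm of the coefficients and \<open>54\<close> for the truncation error.
\<close>

lemma expected_wasserstein_le:
  assumes n: "1 \<le> n" and \<sigma>: "0 < \<sigma>" and P: "prob_space P" and \<phi>: "orthonormal_L2 P \<phi>"
    and lam: "\<And>j. 0 \<le> lam j" and f0: "square_integrable P f0"
    and \<theta>0: "\<theta>0 = vec k (coeff_L2 P \<phi> f0)"
    and inv: "invertible_mat (Lambda lam k)" and op: "op_norm (mat_inv (Lambda lam k)) < real n / 4"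
  shows "(\<integral>\<^sup>+(Y, X). indicator (good_designs D \<phi> n k) X *
           (wasserstein2 k (tgp_posterior lam \<phi> \<sigma> n k Y X)
              (gaussian \<theta>0 ((\<sigma>\<^sup>2 / real n) \<cdot>\<^sub>m 1\<^sub>m k)))\<^sup>2
         \<partial>truth P f0 \<sigma> n)
      \<le> ennreal (54 * (\<sigma>\<^sup>2 * (real k / real n) + (H_norm lam \<theta>0)\<^sup>2 / real n +
           (L2_norm P (\<lambda>x. f0 x - truncation P \<phi> f0 k x))\<^sup>2))"
proof -
  define r where "r x = f0 x - truncation P \<phi> f0 k x" for x
  define H where "H = (H_norm lam \<theta>0)\<^sup>2"
  have H: "H = (\<Sum>j<k. (\<theta>0 $ j)\<^sup>2 / lam j)" "0 \<le> H"
    by (simp_all add: H_def H_norm_square[OF lam] \<theta>0 lam sum_nonneg)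
  have n0: "0 < real n" using n by simp
  define a b c where "a = 9 * \<sigma>\<^sup>2 * real k / real n + 9 / real n * H"
    and "b = 36 / (real n)\<^sup>2" and "c = 54 / real n"
  have abc: "0 \<le> a" "0 \<le> b" "0 \<le> c" using H(2) by (auto simp: a_def b_def c_def)
  have "(\<integral>\<^sup>+(Y, X). indicator (good_designs D \<phi> n k) X *
           (wasserstein2 k (tgp_posterior lam \<phi> \<sigma> n k Y X)
              (gaussian \<theta>0 ((\<sigma>\<^sup>2 / real n) \<cdot>\<^sub>m 1\<^sub>m k)))\<^sup>2 \<partial>truth P f0 \<sigma> n)
    \<le> (\<integral>\<^sup>+(Y, X). ennreal a + ennreal b * (\<Sum>j<k. ennreal ((\<Sum>l<n. \<phi> j (X l) * (Y l - f0 (X l)))\<^sup>2)) +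
        ennreal c * (\<Sum>l<n. ennreal ((r (X l))\<^sup>2)) \<partial>truth P f0 \<sigma> n)"
  proof (rule nn_integral_mono, clarify)
    fix Y and X :: "nat \<Rightarrow> 'a"
    let ?A = "\<Sum>j<k. (\<Sum>l<n. \<phi> j (X l) * (Y l - f0 (X l)))\<^sup>2" and ?R = "\<Sum>l<n. (r (X l))\<^sup>2"
    let ?W = "(wasserstein2 k (tgp_posterior lam \<phi> \<sigma> n k Y X) (gaussian \<theta>0 ((\<sigma>\<^sup>2 / real n) \<cdot>\<^sub>m 1\<^sub>m k)))\<^sup>2"
    have rhs: "ennreal a + ennreal b * (\<Sum>j<k. ennreal ((\<Sum>l<n. \<phi> j (X l) * (Y l - f0 (X l)))\<^sup>2)) +
        ennreal c * (\<Sum>l<n. ennreal ((r (X l))\<^sup>2)) = ennreal (a + b * ?A + c * ?R)"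
      using abc by (simp add: sum_ennreal ennreal_plus ennreal_mult sum_nonneg)
    show "indicator (good_designs D \<phi> n k) X * ?W \<le>
        ennreal a + ennreal b * (\<Sum>j<k. ennreal ((\<Sum>l<n. \<phi> j (X l) * (Y l - f0 (X l)))\<^sup>2)) +
        ennreal c * (\<Sum>l<n. ennreal ((r (X l))\<^sup>2))"
    proof (cases "X \<in> good_designs D \<phi> n k")
      case X: True
      have \<theta>: "\<theta>0 \<in> carrier_vec k" by (simp add: \<theta>0)
      have "?W \<le> ennreal (9 * \<sigma>\<^sup>2 * real k / real n + 3 * (\<Sum>j<k. (tgp_mean lam \<phi> n k Y X $ j - \<theta>0 $ j)\<^sup>2))"
        by (rule wasserstein2_tgp_posterior_le[OF X n \<sigma> lam inv \<theta>])
      also have "\<dots> \<le> ennreal (a + b * ?A + c * ?R)"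
      proof (rule ennreal_leI)
        have tr: "f0 x - (\<Sum>j<k. \<theta>0 $ j * \<phi> j x) = r x" for x
          by (simp add: r_def truncation_def \<theta>0)
        have "(\<Sum>j<k. (tgp_mean lam \<phi> n k Y X $ j - \<theta>0 $ j)\<^sup>2) \<le>
            12 / (real n)\<^sup>2 * (?A + 3 * real n / 2 * ?R + real n / 4 * H)"
          using tgp_mean_error_le[OF X n lam inv op, where Y = Y and \<theta> = "\<lambda>j. \<theta>0 $ j" and \<mu> = "\<lambda>l. f0 (X l)"]
          unfolding tr H(1) .
        hence "9 * \<sigma>\<^sup>2 * real k / real n + 3 * (\<Sum>j<k. (tgp_mean lam \<phi> n k Y X $ j - \<theta>0 $ j)\<^sup>2) \<le>
            9 * \<sigma>\<^sup>2 * real k / real n + 3 * (12 / (real n)\<^sup>2 * (?A + 3 * real n / 2 * ?R + real n / 4 * H))"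
          by (rule add_left_mono[OF mult_left_mono]) simp
        also have "3 * (12 / (real n)\<^sup>2 * (?A + 3 * real n / 2 * ?R + real n / 4 * H)) = b * ?A + c * ?R + 9 / real n * H"
          using n0 by (simp add: b_def c_def power2_eq_square add_divide_distrib distrib_left)
        finally show "9 * \<sigma>\<^sup>2 * real k / real n + 3 * (\<Sum>j<k. (tgp_mean lam \<phi> n k Y X $ j - \<theta>0 $ j)\<^sup>2) \<le> a + b * ?A + c * ?R"
          by (simp add: a_def)
      qed
      finally show ?thesis using X rhs by simp
    qed simp
  qed
  also have "\<dots> = ennreal a + ennreal b * ennreal (\<sigma>\<^sup>2 * real n * real k) + ennreal c * ennreal (real n * (L2_norm P r)\<^sup>2)"
    using square_integrable_truncation_error[OF f0, of \<phi> k] \<phi>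
    by (intro expected_error_terms[OF P \<phi> f0 \<sigma>]) (simp add: r_def[abs_def] orthonormal_L2_def)
  also have "\<dots> = ennreal (a + b * (\<sigma>\<^sup>2 * real n * real k) + c * (real n * (L2_norm P r)\<^sup>2))"
    using abc by (simp add: ennreal_plus ennreal_mult)
  also have "\<dots> \<le> ennreal (54 * (\<sigma>\<^sup>2 * (real k / real n) + H / real n + (L2_norm P r)\<^sup>2))"
  proof (rule ennreal_leI)
    have "a + b * (\<sigma>\<^sup>2 * real n * real k) + c * (real n * (L2_norm P r)\<^sup>2) =
        45 * (\<sigma>\<^sup>2 * (real k / real n)) + 9 * (H / real n) + 54 * (L2_norm P r)\<^sup>2"
      using n0 by (simp add: a_def b_def c_def power2_eq_square)
    moreover have "0 \<le> \<sigma>\<^sup>2 * (real k / real n)" "0 \<le> H / real n" using H(2) by simp_all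
    ultimately show "a + b * (\<sigma>\<^sup>2 * real n * real k) + c * (real n * (L2_norm P r)\<^sup>2) \<le>
        54 * (\<sigma>\<^sup>2 * (real k / real n) + H / real n + (L2_norm P r)\<^sup>2)"
      unfolding distrib_left by linarith
  qed
  finally show ?thesis by (simp add: H_def r_def[abs_def])
qed

theorem theorem3p3:
  shows "\<exists>C::real. 0 < C \<and> ( \<forall>(d::nat) (D :: (nat \<Rightarrow> real) set) (\<rho> :: (nat \<Rightarrow> real) \<Rightarrow> real)
           (K :: (nat \<Rightarrow> real) \<Rightarrow> (nat \<Rightarrow> real) \<Rightarrow> real)
           (lam :: nat \<Rightarrow> real) (\<phi> :: nat \<Rightarrow> (nat \<Rightarrow> real) \<Rightarrow> real)
           (\<sigma> :: real) (f0 :: (nat \<Rightarrow> real) \<Rightarrow> real) (n::nat) (k::nat) (L::real) P \<theta>0.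
      1 \<le> d \<longrightarrow> 1 \<le> n \<longrightarrow> 1 \<le> k \<longrightarrow> 0 < \<sigma> \<longrightarrow>
      is_density d D \<rho> \<longrightarrow>
      P = covariate_law d D \<rho> \<longrightarrow>
      correlation_kernel D K \<longrightarrow> mercer_expansion P K lam \<phi> \<longrightarrow>
      square_integrable P f0 \<longrightarrow> expands_in_L2 P \<phi> f0 \<longrightarrow>
      \<theta>0 = vec k (coeff_L2 P \<phi> f0) \<longrightarrow>
      invertible_mat (Lambda lam k) \<longrightarrow> op_norm (mat_inv (Lambda lam k)) < real n / 4 \<longrightarrow>
      (\<forall>j<k. \<forall>x\<in>D. \<bar>\<phi> j x\<bar> \<le> L) \<longrightarrow> L\<^sup>2 * real k * ln (real k) < real n \<longrightarrow>
      (\<integral>\<^sup>+(Y, X). indicator (good_designs D \<phi> n k) X *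
           (wasserstein2 k (tgp_posterior lam \<phi> \<sigma> n k Y X)
              (gaussian \<theta>0 ((\<sigma>\<^sup>2 / real n) \<cdot>\<^sub>m 1\<^sub>m k)))\<^sup>2
         \<partial>truth P f0 \<sigma> n)
      \<le> ennreal (C * (\<sigma>\<^sup>2 * (real k / real n) + (H_norm lam \<theta>0)\<^sup>2 / real n +
           (L2_norm P (\<lambda>x. f0 x - truncation P \<phi> f0 k x))\<^sup>2)))"
proof (intro exI[of _ 54] conjI allI impI)
  fix d :: nat and D and \<rho> f0 :: "(nat \<Rightarrow> real) \<Rightarrow> real" and K and lam :: "nat \<Rightarrow> real" and \<phi>
    and \<sigma> L :: real and n k :: nat and P \<theta>0
  assume "1 \<le> n" "0 < \<sigma>" "is_density d D \<rho>" "P = covariate_law d D \<rho>" "mercer_expansion P K lam \<phi>"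
    "square_integrable P f0" "\<theta>0 = vec k (coeff_L2 P \<phi> f0)" "invertible_mat (Lambda lam k)"
    "op_norm (mat_inv (Lambda lam k)) < real n / 4"
  thus "(\<integral>\<^sup>+(Y, X). indicator (good_designs D \<phi> n k) X *
           (wasserstein2 k (tgp_posterior lam \<phi> \<sigma> n k Y X)
              (gaussian \<theta>0 ((\<sigma>\<^sup>2 / real n) \<cdot>\<^sub>m 1\<^sub>m k)))\<^sup>2
         \<partial>truth P f0 \<sigma> n)
      \<le> ennreal (54 * (\<sigma>\<^sup>2 * (real k / real n) + (H_norm lam \<theta>0)\<^sup>2 / real n +
           (L2_norm P (\<lambda>x. f0 x - truncation P \<phi> f0 k x))\<^sup>2))"
    by (intro expected_wasserstein_le) (auto simp: mercer_expansion_def prob_space_covariate_law)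
qed simp

end
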